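(* Let $k\ge 2$ be an integer, let $G=\mathrm{BS}(1,k)=\langle a,b\mid b^{-1}ab=a^k\rangle$, and let $\mathsf{NF}\subseteq\{a,A,b,B\}^*$ be the set of normal form words for $G$ (where the letters $A,B$ represent $a^{-1},b^{-1}$). Then the language $$\{x\#y\#z : x,y,z\in\mathsf{NF},\ xy=_G z^{-1}\}$$ over the alphabet $\{a,A,b,B,\#\}$ is an EDT0L language.
   Context: Notation: $\mathbb N_0=\{0,1,2,\dots\}$. $=_G$ denotes equality of the elements of $G$ represented by words, with $A$ representing $a^{-1}$ and $B$ representing $b^{-1}$. Normal form. Let $k\ge2$. For $i,j\in\mathbb Z$, $j\ge 0$, write $a^{i/k^j}$ for the element $b^ja^ib^{-j}$ of $G=\mathrm{BS}(1,k)$ (so $a^q$ is defined for every $q\in\mathbb Z[1/k]$); $A^q$ means $a^{-q}$. Every $g\in G$ can be written as $g=b^r\alpha^u$ with $r\in\mathbb Z$, $\alpha\in\{a,A\}$, and $$u=\frac{i_m}{k^m}+\frac{i_{m-1}}{k^{m-1}}+\cdots+\frac{i_1}{k}+s,\qquad m,s\in\mathbb N_0,\ i_j\in\{0,\dots,k-1\},$$ where either $m=0$ or $i_m\ne0$. The normal form $\mathsf{NF}(g)$ is the word $$b^{t}\,\alpha^{i_m}B\,\alpha^{i_{m-1}}B\cdots\alpha^{i_1}B\,\alpha^s,\qquad t=r+m,$$ over $\{a,A,b,B\}$, where $b^t$ means the word $B^{|t|}$ if $t<0$. Each $g$ has exactly one such word (when $u=0$ the choice of $\alpha$ is immaterial),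 and $\mathsf{NF}=\{\mathsf{NF}(g):g\in G\}$. EDT0L languages. An EDT0L system is a tuple $(\mathcal V,\mathcal U,\mathcal R,v_0)$ where $\mathcal V$ is a finite alphabet, $\mathcal U\subseteq\mathcal V$ is the set of terminals, $v_0\in\mathcal V^*$ is the start word (axiom), and $\mathcal R$ (the rational control) is a regular subset of $\mathcal T^*$ for some finite set $\mathcal T$ of free monoid endomorphisms $\mathcal V^*\to\mathcal V^*$ (called tables). Endomorphisms act on the right, so a string $\tau_1\tau_2\cdots\tau_n\in\mathcal T^*$ is applied by applying $\tau_1$ first, then $\tau_2$, and so on. The language of the system is $\{v\in\mathcal U^*: v=v_0\mathbf r\text{ for some }\mathbf r\in\mathcal R\}$. A language is EDT0L if it is the language of some EDT0L system. *)

theory Defs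
  imports Complex_Main "HOL-Algebra.Group"
begin

text \<open>The generators of \<open>BS(1,k) = \<langle>a, b | b\<^sup>-\<^sup>1 a b = a\<^sup>k\<rangle>\<close> and the letters \<open>A\<close>, \<open>B\<close>
  for their inverses, under names that keep the short variable names free.\<close>

datatype letter = gen_a | gen_A | gen_b | gen_B

fun letter_inv :: "letter \<Rightarrow> letter" where
  "letter_inv gen_a = gen_A"
| "letter_inv gen_A = gen_a"
| "letter_inv gen_b = gen_B"
| "letter_inv gen_B = gen_b"

text \<open>Two words are related iff they represent the same element of \<open>BS(1,k)\<close>: the least
  congruence of the free monoid that makes the two letters of each pair mutually inverse and
  contains the defining relation.\<close>

inductive bs_eq :: "nat \<Rightarrow> letter list \<Rightarrow> letter list \<Rightarrow> bool" for k :: nat where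
  bs_refl: "bs_eq k u u"
| bs_sym: "bs_eq k u v \<Longrightarrow> bs_eq k v u"
| bs_trans: "bs_eq k u v \<Longrightarrow> bs_eq k v w \<Longrightarrow> bs_eq k u w"
| bs_cong: "bs_eq k u v \<Longrightarrow> bs_eq k (p @ u @ q) (p @ v @ q)"
| bs_cancel: "bs_eq k [x, letter_inv x] []"
| bs_rel: "bs_eq k [gen_B, gen_a, gen_b] (replicate k gen_a)"

definition elt :: "nat \<Rightarrow> letter list \<Rightarrow> letter list set" where
  "elt k w = {v. bs_eq k w v}"

definition BS :: "nat \<Rightarrow> letter list set monoid" where
  "BS k = \<lparr>carrier = range (elt k),
           mult = (\<lambda>X Y. \<Union>x\<in>X. \<Union>y\<in>Y. elt k (x @ y)),
           one = elt k []\<rparr>"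

lemma elt_eq_iff: "elt k u = elt k v \<longleftrightarrow> bs_eq k u v"
  unfolding elt_def set_eq_iff mem_Collect_eq by (meson bs_refl bs_sym bs_trans)

lemma bs_eq_append:
  assumes "bs_eq k u u'" "bs_eq k v v'"
  shows "bs_eq k (u @ v) (u' @ v')"
  using bs_trans[OF bs_cong[OF assms(1), of "[]" v, simplified]
    bs_cong[OF assms(2), of u' "[]", simplified]] .

lemma elt_mult: "elt k u \<otimes>\<^bsub>BS k\<^esub> elt k v = elt k (u @ v)"
proof -
  have "elt k (x @ y) = elt k (u @ v)" if "x \<in> elt k u" "y \<in> elt k v" for x y
  proof -
    have "bs_eq k u x" "bs_eq k v y" using that by (simp_all add: elt_def)
    then show ?thesis unfolding elt_eq_iff by (rule bs_sym[OF bs_eq_append])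
  qed
  then have "(\<Union>x\<in>elt k u. \<Union>y\<in>elt k v. elt k (x @ y)) =
      (\<Union>x\<in>elt k u. \<Union>y\<in>elt k v. elt k (u @ v))"
    by (meson SUP_cong)
  moreover have "u \<in> elt k u" "v \<in> elt k v"
    by (simp_all add: elt_def bs_refl)
  ultimately show ?thesis
    unfolding BS_def by auto
qed

definition word_inv :: "letter list \<Rightarrow> letter list" where
  "word_inv w = rev (map letter_inv w)"

lemma bs_eq_word_inv_left: "bs_eq k (word_inv w @ w) []"
proof (induction w)
  case Nil
  show ?case by (simp add: word_inv_def bs_refl)
next
  case (Cons x w)
  have "bs_eq k [letter_inv x, x] []"
    using bs_cancel[of k "letter_inv x"] by (cases x) simp_all
  from bs_cong[OF this, of "word_inv w" w]
  have "bs_eq k (word_inv (x # w) @ x # w) (word_inv w @ w)"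
    by (simp add: word_inv_def)
  then show ?case using Cons.IH by (rule bs_trans)
qed

lemma elt_in_carrier [simp]: "elt k w \<in> carrier (BS k)"
  by (simp add: BS_def)

lemma one_BS: "\<one>\<^bsub>BS k\<^esub> = elt k []"
  by (simp add: BS_def)

lemma group_BS: "group (BS k)"
proof (rule groupI)
  fix X Y assume "X \<in> carrier (BS k)" "Y \<in> carrier (BS k)"
  then obtain x y where "X = elt k x" "Y = elt k y" by (auto simp: BS_def)
  then show "X \<otimes>\<^bsub>BS k\<^esub> Y \<in> carrier (BS k)"
    by (simp add: elt_mult)
next
  show "\<one>\<^bsub>BS k\<^esub> \<in> carrier (BS k)" by (simp add: one_BS)
next
  fix X Y Z assume "X \<in> carrier (BS k)" "Y \<in> carrier (BS k)" "Z \<in> carrier (BS k)"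
  then obtain x y z where "X = elt k x" "Y = elt k y" "Z = elt k z" by (auto simp: BS_def)
  then show "X \<otimes>\<^bsub>BS k\<^esub> Y \<otimes>\<^bsub>BS k\<^esub> Z = X \<otimes>\<^bsub>BS k\<^esub> (Y \<otimes>\<^bsub>BS k\<^esub> Z)"
    by (simp only: elt_mult append_assoc)
next
  fix X assume "X \<in> carrier (BS k)"
  then obtain x where X: "X = elt k x" by (auto simp: BS_def)
  show "\<one>\<^bsub>BS k\<^esub> \<otimes>\<^bsub>BS k\<^esub> X = X"
    unfolding X one_BS elt_mult by simp
  have "elt k (word_inv x) \<in> carrier (BS k)" by simp
  moreover have "elt k (word_inv x) \<otimes>\<^bsub>BS k\<^esub> X = \<one>\<^bsub>BS k\<^esub>"
    unfolding X one_BS elt_mult elt_eq_iff by (rule bs_eq_word_inv_left)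
  ultimately show "\<exists>Y\<in>carrier (BS k). Y \<otimes>\<^bsub>BS k\<^esub> X = \<one>\<^bsub>BS k\<^esub>" by blast
qed

text \<open>\<open>a\<^sup>q\<close> for \<open>q \<in> \<int>[1/k]\<close> is the element \<open>b\<^sup>j a\<^sup>i b\<^sup>-\<^sup>j\<close> for any way of writing
  \<open>q = i/k\<^sup>j\<close>; it does not depend on the choice (lemma \<open>a_pow_eq\<close>).\<close>

definition a_pow :: "nat \<Rightarrow> rat \<Rightarrow> letter list set" where
  "a_pow k q = (THE g. \<exists>(i::int) (j::nat). q = of_int i / of_nat k ^ j \<and>
     g = elt k [gen_b] [^]\<^bsub>BS k\<^esub> j \<otimes>\<^bsub>BS k\<^esub> elt k [gen_a] [^]\<^bsub>BS k\<^esub> i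
           \<otimes>\<^bsub>BS k\<^esub> inv\<^bsub>BS k\<^esub> (elt k [gen_b] [^]\<^bsub>BS k\<^esub> j))"

lemma elt_pow_nat: "elt k w [^]\<^bsub>BS k\<^esub> (n::nat) = elt k (concat (replicate n w))"
proof (induction n)
  case 0
  interpret group "BS k" by (rule group_BS)
  show ?case by (simp add: one_BS)
next
  case (Suc n)
  interpret group "BS k" by (rule group_BS)
  have "concat (replicate n w) @ w = concat (replicate (Suc n) w)"
    by (induction n) simp_all
  with Suc show ?case by (simp add: elt_mult)
qed

lemma a_pow_step:
  fixes i :: int and j :: nat
  shows "elt k [gen_b] [^]\<^bsub>BS k\<^esub> Suc j \<otimes>\<^bsub>BS k\<^esub> elt k [gen_a] [^]\<^bsub>BS k\<^esub> (i * int k)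
           \<otimes>\<^bsub>BS k\<^esub> inv\<^bsub>BS k\<^esub> (elt k [gen_b] [^]\<^bsub>BS k\<^esub> Suc j)
       = elt k [gen_b] [^]\<^bsub>BS k\<^esub> j \<otimes>\<^bsub>BS k\<^esub> elt k [gen_a] [^]\<^bsub>BS k\<^esub> i
           \<otimes>\<^bsub>BS k\<^esub> inv\<^bsub>BS k\<^esub> (elt k [gen_b] [^]\<^bsub>BS k\<^esub> j)"
proof -
  interpret group "BS k" by (rule group_BS)
  define x where "x = elt k [gen_a]"
  define y where "y = elt k [gen_b]"
  have c [simp]: "x \<in> carrier (BS k)" "y \<in> carrier (BS k)"
    by (simp_all add: x_def y_def)
  have canc: "y \<otimes>\<^bsub>BS k\<^esub> (inv\<^bsub>BS k\<^esub> y \<otimes>\<^bsub>BS k\<^esub> z) = z"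
    if "z \<in> carrier (BS k)" for z
    using that by (simp add: m_assoc[symmetric])
  have yi: "inv\<^bsub>BS k\<^esub> y = elt k [gen_B]"
    by (rule inv_equality)
      (simp_all add: y_def elt_mult one_BS elt_eq_iff bs_cancel[of k gen_B, simplified])
  have "inv\<^bsub>BS k\<^esub> y \<otimes>\<^bsub>BS k\<^esub> x \<otimes>\<^bsub>BS k\<^esub> y = elt k (replicate k gen_a)"
    unfolding yi by (simp add: x_def y_def elt_mult elt_eq_iff bs_rel)
  also have "\<dots> = x [^]\<^bsub>BS k\<^esub> k"
    by (simp add: x_def elt_pow_nat)
  finally have rel: "x [^]\<^bsub>BS k\<^esub> k = inv\<^bsub>BS k\<^esub> y \<otimes>\<^bsub>BS k\<^esub> x \<otimes>\<^bsub>BS k\<^esub> y" by simp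
  have conj_nat: "(inv\<^bsub>BS k\<^esub> y \<otimes>\<^bsub>BS k\<^esub> (x \<otimes>\<^bsub>BS k\<^esub> y)) [^]\<^bsub>BS k\<^esub> n
      = inv\<^bsub>BS k\<^esub> y \<otimes>\<^bsub>BS k\<^esub> (x [^]\<^bsub>BS k\<^esub> n \<otimes>\<^bsub>BS k\<^esub> y)" for n :: nat
    by (induction n) (simp_all add: m_assoc canc)
  have conj: "(inv\<^bsub>BS k\<^esub> y \<otimes>\<^bsub>BS k\<^esub> (x \<otimes>\<^bsub>BS k\<^esub> y)) [^]\<^bsub>BS k\<^esub> i
      = inv\<^bsub>BS k\<^esub> y \<otimes>\<^bsub>BS k\<^esub> (x [^]\<^bsub>BS k\<^esub> i \<otimes>\<^bsub>BS k\<^esub> y)"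
    by (cases i rule: int_cases2)
      (simp_all add: int_pow_int int_pow_neg conj_nat inv_mult_group m_assoc)
  have "x [^]\<^bsub>BS k\<^esub> (i * int k) = (x [^]\<^bsub>BS k\<^esub> int k) [^]\<^bsub>BS k\<^esub> i"
    by (simp add: int_pow_pow mult.commute)
  also have "\<dots> = inv\<^bsub>BS k\<^esub> y \<otimes>\<^bsub>BS k\<^esub> x [^]\<^bsub>BS k\<^esub> i \<otimes>\<^bsub>BS k\<^esub> y"
    by (simp add: int_pow_int rel m_assoc conj)
  finally show ?thesis
    unfolding x_def[symmetric] y_def[symmetric]
    by (simp add: inv_mult_group m_assoc canc)
qed

lemma a_pow_eq:
  fixes i :: int and j :: nat
  assumes "k > 0"
  shows "a_pow k (of_int i / of_nat k ^ j) =
     elt k [gen_b] [^]\<^bsub>BS k\<^esub> j \<otimes>\<^bsub>BS k\<^esub> elt k [gen_a] [^]\<^bsub>BS k\<^esub> i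
       \<otimes>\<^bsub>BS k\<^esub> inv\<^bsub>BS k\<^esub> (elt k [gen_b] [^]\<^bsub>BS k\<^esub> j)"
proof -
  define f where "f i j = elt k [gen_b] [^]\<^bsub>BS k\<^esub> j \<otimes>\<^bsub>BS k\<^esub> elt k [gen_a] [^]\<^bsub>BS k\<^esub> i
       \<otimes>\<^bsub>BS k\<^esub> inv\<^bsub>BS k\<^esub> (elt k [gen_b] [^]\<^bsub>BS k\<^esub> j)" for i :: int and j :: nat
  have step: "f (i * int k ^ d) (j + d) = f i j" for i j d
  proof (induction d)
    case (Suc d)
    have "i * int k ^ Suc d = i * int k ^ d * int k" by simp
    then have "f (i * int k ^ Suc d) (j + Suc d) = f (i * int k ^ d) (j + d)"
      unfolding f_def using a_pow_step[of k "j + d" "i * int k ^ d"] by (simp only: add_Suc_right)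
    with Suc show ?case by simp
  qed simp
  have "f i' j' = f i j"
    if eq: "(of_int i :: rat) / of_nat k ^ j = of_int i' / of_nat k ^ j'" for i' j'
  proof -
    have "(of_int i :: rat) * of_nat k ^ j' = of_int i' * of_nat k ^ j"
      using eq assms by (simp add: frac_eq_eq)
    then have "(of_int (i * int k ^ j') :: rat) = of_int (i' * int k ^ j)" by simp
    then have "i * int k ^ j' = i' * int k ^ j" by (simp only: of_int_eq_iff)
    then show ?thesis
      using step[of i j' j] step[of i' j j'] by (simp add: add.commute)
  qed
  then show ?thesis
    unfolding a_pow_def f_def by (intro the_equality) blast+
qed

definition b_word :: "int \<Rightarrow> letter list" where
  "b_word t = (if t \<ge> 0 then replicate (nat t) gen_b else replicate (nat (- t)) gen_B)"

text \<open>\<open>is_nf k g w\<close>: the word \<open>w\<close> is the normal form of the group element \<open>g = b\<^sup>r \<alpha>\<^sup>u\<close>,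
  where \<open>i j\<close> is the coefficient of \<open>k\<^sup>-\<^sup>j\<close> in \<open>u\<close>, and the list \<open>rev [1..<Suc m]\<close>
  is \<open>m, m - 1, \<dots>, 1\<close>.\<close>

definition is_nf :: "nat \<Rightarrow> letter list set \<Rightarrow> letter list \<Rightarrow> bool" where
  "is_nf k g w \<longleftrightarrow>
     (\<exists>(r::int) \<alpha> (m::nat) (s::nat) (i :: nat \<Rightarrow> nat) (u::rat).
        \<alpha> \<in> {gen_a, gen_A} \<and>
        (\<forall>j\<in>{1..m}. i j \<in> {0..k - 1}) \<and>
        (m = 0 \<or> i m \<noteq> 0) \<and>
        u = (\<Sum>j=1..m. of_nat (i j) / of_nat k ^ j) + of_nat s \<and>
        g = elt k [gen_b] [^]\<^bsub>BS k\<^esub> r \<otimes>\<^bsub>BS k\<^esub> a_pow k (if \<alpha> = gen_a then u else - u) \<and>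
        w = b_word (r + int m) @
            concat (map (\<lambda>j. replicate (i j) \<alpha> @ [gen_B]) (rev [1..<Suc m])) @
            replicate s \<alpha>)"

definition NF :: "nat \<Rightarrow> letter list set" where
  "NF k = {w. \<exists>g\<in>carrier (BS k). is_nf k g w}"

inductive nfa_path :: "('q \<times> 't \<times> 'q) set \<Rightarrow> 'q \<Rightarrow> 't list \<Rightarrow> 'q \<Rightarrow> bool"
  for \<Delta> :: "('q \<times> 't \<times> 'q) set" where
  nfa_path_Nil: "nfa_path \<Delta> p [] p"
| nfa_path_Cons: "(p, x, q) \<in> \<Delta> \<Longrightarrow> nfa_path \<Delta> q w r \<Longrightarrow> nfa_path \<Delta> p (x # w) r"

text \<open>Regularity is acceptance by a finite (nondeterministic) automaton. States can be taken to
  be natural numbers without loss of generality.\<close>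

definition regular_over :: "'t set \<Rightarrow> 't list set \<Rightarrow> bool" where
  "regular_over S L \<longleftrightarrow>
     (\<exists>(Q :: nat set) \<Delta> q\<^sub>0 F.
        finite Q \<and> \<Delta> \<subseteq> Q \<times> S \<times> Q \<and> q\<^sub>0 \<in> Q \<and> F \<subseteq> Q \<and>
        L = {w. \<exists>f\<in>F. nfa_path \<Delta> q\<^sub>0 w f})"

text \<open>A table is a function on all words of the ambient type; only its values on words over
  \<open>V\<close> matter.\<close>

definition free_monoid_endo :: "'v set \<Rightarrow> ('v list \<Rightarrow> 'v list) \<Rightarrow> bool" where
  "free_monoid_endo V \<tau> \<longleftrightarrow>
     (\<forall>x\<in>lists V. \<tau> x \<in> lists V) \<and> \<tau> [] = [] \<and>
     (\<forall>x\<in>lists V. \<forall>y\<in>lists V. \<tau> (x @ y) = \<tau> x @ \<tau> y)"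

definition edt0l_system ::
  "'v set \<Rightarrow> 'v set \<Rightarrow> ('v list \<Rightarrow> 'v list) list set \<Rightarrow> 'v list \<Rightarrow> bool" where
  "edt0l_system V U R v\<^sub>0 \<longleftrightarrow>
     finite V \<and> U \<subseteq> V \<and> v\<^sub>0 \<in> lists V \<and>
     (\<exists>T. finite T \<and> (\<forall>\<tau>\<in>T. free_monoid_endo V \<tau>) \<and> regular_over T R)"

text \<open>\<open>fold\<close> applies the first table of the control word first.\<close>

definition edt0l_language ::
  "'v set \<Rightarrow> ('v list \<Rightarrow> 'v list) list set \<Rightarrow> 'v list \<Rightarrow> 'v list set" where
  "edt0l_language U R v\<^sub>0 = {v \<in> lists U. \<exists>r\<in>R. v = fold (\<lambda>\<tau> x. \<tau> x) r v\<^sub>0}"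

text \<open>The extended alphabet \<open>V\<close> of a system for a language over \<open>'a\<close> is a finite subset of
  \<open>'a + nat\<close>, which has room for the letters of the language (embedded by \<open>Inl\<close>) and for
  any finite number of further symbols.\<close>

definition EDT0L :: "'a list set \<Rightarrow> bool" where
  "EDT0L L \<longleftrightarrow>
     (\<exists>(V :: ('a + nat) set) U R v\<^sub>0.
        edt0l_system V U R v\<^sub>0 \<and> map Inl ` L = edt0l_language U R v\<^sub>0)"

datatype symbol = Gen letter | Hash

end

theory Submission imports Defs begin

text \<open>Read a word as a path of heights: \<open>b\<close> lowers the height, \<open>B\<close> raises it, and a letter
  \<open>a\<close> or \<open>A\<close> read at height \<open>h\<close> contributes \<open>\<plusminus>k\<^sup>h\<close>. A word is trivial in \<open>BS(1,k)\<close> iff its path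
  is closed and the contributions sum to zero. A normal form goes straight to a lowest height \<open>L\<close>,
  climbs to a height \<open>P\<close> while writing base-\<open>k\<close> digits, and writes the rest in unary at height \<open>P\<close>;
  so up to its sign it is given by a natural number \<open>v\<close> together with \<open>P\<close>, \<open>L\<close> and the height
  at which it starts.

  For three normal forms whose concatenation is a closed path, the three numbers \<open>v\<close> are written
  simultaneously, one digit of each at a time from the top height downwards. Above \<open>P\<close>, a digit is
  appended to the unary part by Horner's rule (a table that maps a letter to its \<open>k\<close>-th power);
  below \<open>P\<close> it is written out. The signed sum of the three number prefixes has to remain in
  \<open>[-3, 3]\<close> to vanish eventually, so the finite control can keep track of it exactly.\<close>

section \<open>Trivial words\<close>

fun letter_height :: "letter \<Rightarrow> int" where
  "letter_height gen_b = - 1"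
| "letter_height gen_B = 1"
| "letter_height _ = 0"

fun letter_value :: "letter \<Rightarrow> real" where
  "letter_value gen_a = 1"
| "letter_value gen_A = - 1"
| "letter_value _ = 0"

definition height :: "letter list \<Rightarrow> int" where
  "height w = sum_list (map letter_height w)"

text \<open>For \<open>h = 0\<close> this is the translation part of the image of the word in the
  affine group of the line; \<open>height\<close> gives the exponent of the scaling part. Reals with
  \<open>powi\<close> are used because heights may be negative.\<close>

fun val :: "nat \<Rightarrow> int \<Rightarrow> letter list \<Rightarrow> real" where
  "val k h [] = 0"
| "val k h (x # w) = letter_value x * real k powi h + val k (h + letter_height x) w"

lemma height_simps [simp]:
  "height [] = 0" "height (x # w) = letter_height x + height w"
  "height (u @ w) = height u + height w"
  by (simp_all add: height_def)

lemma val_append [simp]: "val k h (u @ w) = val k h u + val k (h + height u) w"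
  by (induction u arbitrary: h) (simp_all add: add.assoc)

lemma height_replicate [simp]: "height (replicate n x) = int n * letter_height x"
  by (induction n) (simp_all add: algebra_simps)

lemma val_replicate:
  "letter_height x = 0 \<Longrightarrow> val k h (replicate n x) = real n * letter_value x * real k powi h"
  by (induction n) (simp_all add: algebra_simps)

lemma val_eq_0: "(\<And>x. x \<in> set w \<Longrightarrow> letter_value x = 0) \<Longrightarrow> val k h w = 0"
  by (induction w arbitrary: h) simp_all

text \<open>Induction over the congruence. All start heights \<open>h\<close> are needed because in
  \<open>bs_cong\<close> the prefix shifts the height at which the related words are read.\<close>

lemma bs_eq_invariant:
  assumes "bs_eq k u w" "k > 0"
  shows "height u = height w \<and> (\<forall>h. val k h u = val k h w)"
  using assms(1)
proof induction
  case (bs_cancel x)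
  then show ?case by (cases x) simp_all
next
  case bs_rel
  then show ?case using assms(2) by (simp add: val_replicate power_int_add_1)
qed auto

lemma bs_eq_cancel_in: "bs_eq k (p @ [x, letter_inv x] @ q) (p @ q)"
  using bs_cong[OF bs_cancel[of k x], of p q] by simp

section \<open>Rewriting a word to a power of \<open>b\<close>, a power of \<open>a\<close> and a
  power of \<open>B\<close>\<close>

definition a_word :: "int \<Rightarrow> letter list" where
  "a_word n = (if n \<ge> 0 then replicate (nat n) gen_a else replicate (nat (- n)) gen_A)"

lemma height_a_word [simp]: "height (a_word n) = 0"
  by (simp add: a_word_def)

lemma val_a_word: "val k h (a_word n) = of_int n * real k powi h"
  by (simp add: a_word_def val_replicate)

lemma bs_eq_a_Cons: "bs_eq k (gen_a # a_word n) (a_word (n + 1))"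
proof (cases "n \<ge> 0")
  case True
  then have "gen_a # a_word n = a_word (n + 1)"
    by (simp add: a_word_def nat_add_distrib)
  then show ?thesis by (simp add: bs_refl)
next
  case False
  then have "nat (- n) = Suc (nat (- n - 1))" by simp
  then have "a_word n = gen_A # a_word (n + 1)"
    using False by (auto simp: a_word_def)
  then show ?thesis using bs_eq_cancel_in[of k "[]" gen_a] by simp
qed

lemma bs_eq_A_Cons: "bs_eq k (gen_A # a_word n) (a_word (n - 1))"
proof (cases "n > 0")
  case True
  then have "nat n = Suc (nat (n - 1))" by simp
  then have "a_word n = gen_a # a_word (n - 1)"
    using True by (auto simp: a_word_def)
  then show ?thesis using bs_eq_cancel_in[of k "[]" gen_A] by simp
next
  case False
  then have "nat (- (n - 1)) = Suc (nat (- n))" by simp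
  then have "gen_A # a_word n = a_word (n - 1)"
    using False by (auto simp: a_word_def)
  then show ?thesis by (simp add: bs_refl)
qed

lemma bs_eq_Cons: "bs_eq k u w \<Longrightarrow> bs_eq k (x # u) (x # w)"
  using bs_cong[of k u w "[x]" "[]"] by simp

lemma bs_eq_append_right: "bs_eq k u w \<Longrightarrow> bs_eq k (u @ q) (w @ q)"
  using bs_cong[of k u w "[]" q] by simp

lemma bs_eq_append_left: "bs_eq k u w \<Longrightarrow> bs_eq k (p @ u) (p @ w)"
  using bs_cong[of k u w p "[]"] by simp

lemma bs_eq_a_power_append:
  "bs_eq k (replicate n gen_a @ a_word i) (a_word (i + int n))"
proof (induction n)
  case (Suc n)
  then show ?case
    using bs_trans[OF bs_eq_Cons[OF Suc] bs_eq_a_Cons] by (simp add: ac_simps)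
qed (simp add: bs_refl)

lemma bs_eq_A_power_append:
  "bs_eq k (replicate n gen_A @ a_word i) (a_word (i - int n))"
proof (induction n)
  case (Suc n)
  then show ?case
    using bs_trans[OF bs_eq_Cons[OF Suc] bs_eq_A_Cons] by (simp add: algebra_simps)
qed (simp add: bs_refl)

lemma bs_eq_a_word_append: "bs_eq k (a_word i @ a_word j) (a_word (i + j))"
  using bs_eq_a_power_append[of k "nat i" j] bs_eq_A_power_append[of k "nat (- i)" j]
  by (auto simp: a_word_def[of i] ac_simps split: if_splits)

lemma bs_eq_a_b: "bs_eq k [gen_a, gen_b] (gen_b # a_word (int k))"
proof -
  have "bs_eq k [gen_b, gen_B, gen_a, gen_b] [gen_a, gen_b]"
    using bs_eq_cancel_in[of k "[]" gen_b "[gen_a, gen_b]"] by simp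
  moreover have "bs_eq k [gen_b, gen_B, gen_a, gen_b] (gen_b # a_word (int k))"
    using bs_eq_Cons[OF bs_rel[of k], of gen_b] by (simp add: a_word_def)
  ultimately show ?thesis by (meson bs_sym bs_trans)
qed

text \<open>Insert \<open>a^k a^(-k)\<close> on the right, turn \<open>b a^k\<close> back into
  \<open>a b\<close> by \<open>bs_eq_a_b\<close>, and cancel \<open>A a\<close>.\<close>

lemma bs_eq_A_b: "bs_eq k [gen_A, gen_b] (gen_b # a_word (- int k))"
proof -
  have "bs_eq k ([gen_A, gen_b] @ (a_word (int k) @ a_word (- int k))) ([gen_A, gen_b] @ a_word 0)"
    by (rule bs_eq_append_left) (use bs_eq_a_word_append[of k "int k" "- int k"] in simp)
  moreover have "bs_eq k ([gen_A, gen_b] @ (a_word (int k) @ a_word (- int k)))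
      ([gen_A, gen_a, gen_b] @ a_word (- int k))"
    using bs_cong[OF bs_sym[OF bs_eq_a_b[of k]], of "[gen_A]" "a_word (- int k)"] by simp
  moreover have "bs_eq k ([gen_A, gen_a, gen_b] @ a_word (- int k)) (gen_b # a_word (- int k))"
    using bs_eq_cancel_in[of k "[]" gen_A "gen_b # a_word (- int k)"] by simp
  moreover have "a_word 0 = []" by (simp add: a_word_def)
  ultimately show ?thesis by (metis append_Nil2 bs_sym bs_trans)
qed

lemma bs_eq_letter_b:
  assumes "x \<in> {gen_a, gen_A}"
  obtains e where "bs_eq k [x, gen_b] (gen_b # a_word e)"
  using assms bs_eq_a_b bs_eq_A_b by blast

text \<open>Here and in the next lemmas only the existence of an exponent is recorded;
  \<open>bs_eq_Nil_iff\<close> later determines the final one from the invariant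
  \<open>val\<close>.\<close>

lemma bs_eq_a_word_b: "\<exists>e. bs_eq k (a_word n @ [gen_b]) (gen_b # a_word e)"
proof -
  have "\<exists>e. bs_eq k (replicate l x @ [gen_b]) (gen_b # a_word e)"
    if x: "x \<in> {gen_a, gen_A}" for l x
  proof (induction l)
    case 0
    show ?case using bs_refl[of k "[gen_b]"] by (intro exI[of _ 0]) (simp add: a_word_def)
  next
    case (Suc l)
    then obtain e where e: "bs_eq k (replicate l x @ [gen_b]) (gen_b # a_word e)" by blast
    obtain f where f: "bs_eq k [x, gen_b] (gen_b # a_word f)"
      using bs_eq_letter_b[OF x] .
    from bs_eq_Cons[OF e, of x] bs_eq_append_right[OF f, of "a_word e"]
      bs_eq_Cons[OF bs_eq_a_word_append[of k f e], of gen_b]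
    have "bs_eq k (replicate (Suc l) x @ [gen_b]) (gen_b # a_word (f + e))"
      by simp (meson bs_trans)
    then show ?case by blast
  qed
  then show ?thesis by (simp add: a_word_def)
qed

lemma bs_eq_a_word_b_power:
  "\<exists>e. bs_eq k (a_word n @ replicate i gen_b) (replicate i gen_b @ a_word e)"
proof (induction i arbitrary: n)
  case 0
  show ?case using bs_refl by auto
next
  case (Suc i)
  obtain e where "bs_eq k (a_word n @ [gen_b]) (gen_b # a_word e)"
    using bs_eq_a_word_b by blast
  from bs_eq_append_right[OF this, of "replicate i gen_b"]
  have 1: "bs_eq k (a_word n @ replicate (Suc i) gen_b) (gen_b # a_word e @ replicate i gen_b)"
    by simp
  obtain f where "bs_eq k (a_word e @ replicate i gen_b) (replicate i gen_b @ a_word f)"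
    using Suc by blast
  from bs_trans[OF 1 bs_eq_Cons[OF this]] show ?case by auto
qed

lemma bs_eq_B_a_word: "\<exists>e. bs_eq k (gen_B # a_word n) (a_word e @ [gen_B])"
proof -
  obtain e where "bs_eq k (a_word n @ [gen_b]) (gen_b # a_word e)"
    using bs_eq_a_word_b by blast
  from bs_cong[OF this, of "[gen_B]" "[gen_B]"]
  have "bs_eq k (gen_B # a_word n @ [gen_b, gen_B]) (gen_B # gen_b # a_word e @ [gen_B])"
    by simp
  moreover have "bs_eq k (gen_B # a_word n @ [gen_b, gen_B]) (gen_B # a_word n)"
    using bs_eq_cancel_in[of k "gen_B # a_word n" gen_b "[]"] by simp
  moreover have "bs_eq k (gen_B # gen_b # a_word e @ [gen_B]) (a_word e @ [gen_B])"
    using bs_eq_cancel_in[of k "[]" gen_B "a_word e @ [gen_B]"] by simp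
  ultimately show ?thesis by (meson bs_sym bs_trans)
qed

text \<open>Letters are prepended one at a time: \<open>a\<close> and \<open>A\<close> move right
  through the leading letters \<open>b\<close>, while \<open>B\<close> cancels a leading
  \<open>b\<close> or, if there is none, passes the power of \<open>a\<close>.\<close>

lemma bs_eq_standard_form:
  "\<exists>i n j. bs_eq k w (replicate i gen_b @ a_word n @ replicate j gen_B)"
proof (induction w)
  case Nil
  show ?case using bs_refl[of k "[]"]
    by (intro exI[of _ 0] exI[of _ "0::int"]) (simp add: a_word_def)
next
  case (Cons x w)
  then obtain i n j where "bs_eq k w (replicate i gen_b @ a_word n @ replicate j gen_B)" by blast
  from bs_eq_Cons[OF this]
  have w: "bs_eq k (x # w) (x # replicate i gen_b @ a_word n @ replicate j gen_B)" .
  have unit: "\<exists>i n j. bs_eq k (x # w) (replicate i gen_b @ a_word n @ replicate j gen_B)"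
    if c: "[x] = a_word c" for c
  proof -
    obtain e where "bs_eq k ([x] @ replicate i gen_b) (replicate i gen_b @ a_word e)"
      using bs_eq_a_word_b_power[of k c i] c by metis
    from bs_eq_append_right[OF this, of "a_word n @ replicate j gen_B"]
      bs_cong[OF bs_eq_a_word_append[of k e n], of "replicate i gen_b" "replicate j gen_B"]
    have "bs_eq k (x # replicate i gen_b @ a_word n @ replicate j gen_B)
        (replicate i gen_b @ a_word (e + n) @ replicate j gen_B)"
      by simp (meson bs_trans)
    with w show ?thesis by (meson bs_trans)
  qed
  show ?case
  proof (cases x)
    case gen_a
    then show ?thesis using unit[of 1] by (simp add: a_word_def)
  next
    case gen_A
    then show ?thesis using unit[of "- 1"] by (simp add: a_word_def)
  next
    case gen_b
    then show ?thesis using w by (metis append_Cons replicate_Suc)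
  next
    case gen_B
    show ?thesis
    proof (cases i)
      case 0
      obtain e where "bs_eq k (gen_B # a_word n) (a_word e @ [gen_B])"
        using bs_eq_B_a_word by blast
      from bs_eq_append_right[OF this, of "replicate j gen_B"] w gen_B 0
      have "bs_eq k (x # w) (replicate 0 gen_b @ a_word e @ replicate (Suc j) gen_B)"
        by simp (meson bs_trans)
      then show ?thesis by blast
    next
      case (Suc i')
      with w gen_B have
        "bs_eq k (x # w) ([gen_B, gen_b] @ replicate i' gen_b @ a_word n @ replicate j gen_B)"
        by simp
      with bs_eq_cancel_in[of k "[]" gen_B "replicate i' gen_b @ a_word n @ replicate j gen_B"]
      show ?thesis by simp (meson bs_trans)
    qed
  qed
qed

lemma bs_eq_b_B_power: "bs_eq k (replicate i gen_b @ replicate i gen_B) []"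
proof (induction i)
  case (Suc i)
  have "replicate (Suc i) gen_b @ replicate (Suc i) gen_B =
      replicate i gen_b @ [gen_b, gen_B] @ replicate i gen_B"
    by (simp add: replicate_app_Cons_same)
  then show ?case
    using bs_eq_cancel_in[of k "replicate i gen_b" gen_b "replicate i gen_B"] Suc
    by (metis bs_trans letter_inv.simps(3))
qed (simp add: bs_refl)

text \<open>On the standard form the height forces \<open>i = j\<close> and the value
  \<open>n k^(h - i)\<close> forces \<open>n = 0\<close>; then the powers of \<open>b\<close> and
  \<open>B\<close> cancel.\<close>

lemma bs_eq_Nil_iff:
  assumes "k > 0"
  shows "bs_eq k w [] \<longleftrightarrow> height w = 0 \<and> val k h w = 0"
proof
  assume "bs_eq k w []"
  from bs_eq_invariant[OF this assms] show "height w = 0 \<and> val k h w = 0" by simp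
next
  assume w: "height w = 0 \<and> val k h w = 0"
  obtain i n j where eq: "bs_eq k w (replicate i gen_b @ a_word n @ replicate j gen_B)"
    using bs_eq_standard_form by blast
  have "val k h' (replicate j gen_B) = 0" "val k h' (replicate i gen_b) = 0" for h'
    by (auto intro: val_eq_0)
  with bs_eq_invariant[OF eq assms] w assms have "i = j" "n = 0"
    by (auto simp: val_a_word)
  then show "bs_eq k w []"
    using bs_trans[OF eq] bs_eq_b_B_power[of k i] by (simp add: a_word_def)
qed

lemma elt_eq_inv_iff: "elt k u = inv\<^bsub>BS k\<^esub> (elt k w) \<longleftrightarrow> bs_eq k (u @ w) []"
proof -
  interpret group "BS k" by (rule group_BS)
  have "elt k u = inv\<^bsub>BS k\<^esub> (elt k w) \<longleftrightarrow> elt k u \<otimes>\<^bsub>BS k\<^esub> elt k w = \<one>\<^bsub>BS k\<^esub>"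
    by (metis elt_in_carrier inv_equality l_inv)
  then show ?thesis by (simp add: elt_mult one_BS elt_eq_iff)
qed

section \<open>Normal forms\<close>

text \<open>\<open>nf_word k t \<alpha> N m\<close> is the normal form with \<open>N = u k\<^sup>m\<close>: the digit \<open>i\<^sub>j\<close> of \<open>u\<close> is the
  digit of \<open>N\<close> at position \<open>m - j\<close>, and \<open>s = N div k\<^sup>m\<close>. Position \<open>0\<close> is written first.\<close>

definition nf_digits :: "nat \<Rightarrow> 'a \<Rightarrow> 'a \<Rightarrow> nat \<Rightarrow> nat \<Rightarrow> nat \<Rightarrow> 'a list" where
  "nf_digits k x y N l m =
     concat (map (\<lambda>j. replicate (N div k ^ j mod k) x @ [y]) [l..<m]) @ replicate (N div k ^ m) x"

definition nf_word :: "nat \<Rightarrow> int \<Rightarrow> letter \<Rightarrow> nat \<Rightarrow> nat \<Rightarrow> letter list" where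
  "nf_word k t \<alpha> N m = b_word t @ nf_digits k \<alpha> gen_B N 0 m"

lemma upt_eq_map_Suc:
  assumes "l < m" shows "[l..<m] = l # map Suc [l..<m - 1]"
proof -
  from assms obtain n where "m = Suc n" by (cases m) auto
  with assms show ?thesis by (simp add: upt_conv_Cons map_Suc_upt del: upt_Suc)
qed

lemma nf_digits_0:
  assumes "m > 0"
  shows "nf_digits k x y N 0 m = replicate (N mod k) x @ y # nf_digits k x y (N div k) 0 (m - 1)"
proof -
  have "k ^ m = k * k ^ (m - 1)" using assms by (cases m) auto
  then show ?thesis
    by (simp add: nf_digits_def upt_eq_map_Suc[OF assms] o_def div_mult2_eq)
qed

lemma nf_digits_Suc:
  "nf_digits k x y N (Suc l) (Suc m) = nf_digits k x y (N div k) l m"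
  by (simp add: nf_digits_def o_def div_mult2_eq del: upt_Suc flip: map_Suc_upt)

lemma nf_digits_shift: "nf_digits k x y N l (l + m) = nf_digits k x y (N div k ^ l) 0 m"
  by (induction l arbitrary: N) (simp_all add: nf_digits_Suc div_mult2_eq)

text \<open>Horner's rule: \<open>N\<close> is built from \<open>e 0\<close> and the number with the
  shifted digits.\<close>

lemma exists_digits:
  assumes "k > 0" "\<forall>j<m. e j < k"
  shows "\<exists>N. (\<forall>j<m. N div k ^ j mod k = e j) \<and> N div k ^ m = (s::nat)"
  using assms(2)
proof (induction m arbitrary: e)
  case 0
  show ?case by simp
next
  case (Suc m)
  then have "\<forall>j<m. e (Suc j) < k" by simp
  then obtain N where N: "\<forall>j<m. N div k ^ j mod k = e (Suc j)" "N div k ^ m = s"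
    using Suc.IH[of "\<lambda>j. e (Suc j)"] by blast
  have e0: "e 0 < k" using Suc.prems by simp
  have div: "(e 0 + k * N) div k ^ Suc j = N div k ^ j" for j
    using e0 by (simp add: div_mult2_eq)
  have "(e 0 + k * N) div k ^ j mod k = e j" if "j < Suc m" for j
    using that N(1) e0 div by (cases j) auto
  with N(2) div show ?case by blast
qed

lemma rev_upt_eq: "rev [1..<Suc m] = map (\<lambda>j. m - j) [0..<m]"
  by (rule nth_equalityI) (auto simp: rev_nth simp del: upt_Suc)

lemma a_pow_closed:
  assumes "k > 0" shows "a_pow k (of_int n / of_nat k ^ j) \<in> carrier (BS k)"
proof -
  interpret group "BS k" by (rule group_BS)
  show ?thesis unfolding a_pow_eq[OF assms] by simp
qed

text \<open>\<open>a_pow\<close> is a definite description, evaluated by \<open>a_pow_eq\<close> on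
  such quotients; \<open>NF_iff\<close> uses this to place the group element in the carrier.\<close>

lemma finite_expansion_eq_quotient:
  assumes "k > 0"
  shows "\<exists>n. (\<Sum>j=1..m. of_nat (i j) / of_nat k ^ j) + of_nat s = (of_int n / of_nat k ^ m :: rat)"
proof (induction m)
  case 0
  show ?case by (intro exI[of _ "int s"]) simp
next
  case (Suc m)
  then obtain n where
    "(\<Sum>j=1..m. of_nat (i j) / of_nat k ^ j) + of_nat s = (of_int n / of_nat k ^ m :: rat)" by blast
  then have "(\<Sum>j=1..Suc m. of_nat (i j) / of_nat k ^ j) + of_nat s =
      (of_int n / of_nat k ^ m + of_nat (i (Suc m)) / of_nat k ^ Suc m :: rat)" by simp
  also have "\<dots> = of_int (n * int k + int (i (Suc m))) / of_nat k ^ Suc m"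
    using assms by (simp add: field_simps)
  finally show ?case by blast
qed

text \<open>Every \<open>t\<close> occurs since \<open>r = t - m\<close> is free. The coefficient
  \<open>i m\<close> is the lowest digit \<open>N mod k\<close>, so \<open>i m \<noteq> 0\<close>
  becomes \<open>\<not> k dvd N\<close>.\<close>

lemma NF_iff:
  assumes "k \<ge> 2"
  shows "w \<in> NF k \<longleftrightarrow> (\<exists>t \<alpha> N m. \<alpha> \<in> {gen_a, gen_A} \<and> (m = 0 \<or> \<not> k dvd N) \<and>
    w = nf_word k t \<alpha> N m)"
proof
  assume "w \<in> NF k"
  then obtain r \<alpha> m s i where \<alpha>: "\<alpha> \<in> {gen_a, gen_A}" and i: "\<forall>j\<in>{1..m}. i j \<in> {0..k - 1}"
    and m: "m = 0 \<or> i m \<noteq> 0"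
    and w: "w = b_word (r + int m) @
            concat (map (\<lambda>j. replicate (i j) \<alpha> @ [gen_B]) (rev [1..<Suc m])) @ replicate s \<alpha>"
    unfolding NF_def is_nf_def by blast
  have "\<forall>j<m. i (m - j) < k"
  proof (intro allI impI)
    fix j assume "j < m"
    then have "m - j \<in> {1..m}" by auto
    with i assms have "i (m - j) \<le> k - 1" by auto
    with assms show "i (m - j) < k" by simp
  qed
  then obtain N where N: "\<forall>j<m. N div k ^ j mod k = i (m - j)" "N div k ^ m = s"
    using exists_digits[of k m "\<lambda>j. i (m - j)" s] assms by auto
  have "map (\<lambda>j. replicate (i j) \<alpha> @ [gen_B]) (rev [1..<Suc m]) =
      map (\<lambda>j. replicate (N div k ^ j mod k) \<alpha> @ [gen_B]) [0..<m]"
    unfolding rev_upt_eq map_map using N(1) by simp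
  then have "w = nf_word k (r + int m) \<alpha> N m"
    unfolding w nf_word_def nf_digits_def N(2) by simp
  moreover have "m = 0 \<or> \<not> k dvd N"
    using m N(1) by (cases "m = 0") (auto simp: dvd_eq_mod_eq_0)
  ultimately show "\<exists>t \<alpha> N m. \<alpha> \<in> {gen_a, gen_A} \<and> (m = 0 \<or> \<not> k dvd N) \<and> w = nf_word k t \<alpha> N m"
    using \<alpha> by blast
next
  assume "\<exists>t \<alpha> N m. \<alpha> \<in> {gen_a, gen_A} \<and> (m = 0 \<or> \<not> k dvd N) \<and> w = nf_word k t \<alpha> N m"
  then obtain t \<alpha> N m where \<alpha>: "\<alpha> \<in> {gen_a, gen_A}" and N: "m = 0 \<or> \<not> k dvd N"
    and w: "w = nf_word k t \<alpha> N m" by blast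
  define i where "i j = N div k ^ (m - j) mod k" for j
  define s where "s = N div k ^ m"
  define u :: rat where "u = (\<Sum>j=1..m. of_nat (i j) / of_nat k ^ j) + of_nat s"
  define g where "g = elt k [gen_b] [^]\<^bsub>BS k\<^esub> (t - int m) \<otimes>\<^bsub>BS k\<^esub>
    a_pow k (if \<alpha> = gen_a then u else - u)"
  interpret group "BS k" by (rule group_BS)
  obtain n where "u = of_int n / of_nat k ^ m"
    using finite_expansion_eq_quotient[of k i m s] assms unfolding u_def by auto
  then have "(if \<alpha> = gen_a then u else - u) =
      of_int (if \<alpha> = gen_a then n else - n) / of_nat k ^ m" by simp
  then have "g \<in> carrier (BS k)"
    unfolding g_def using a_pow_closed[of k _ m] assms by simp
  moreover have "is_nf k g w"
    unfolding is_nf_def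
  proof (rule exI[of _ "t - int m"], rule exI[of _ \<alpha>], rule exI[of _ m], rule exI[of _ s],
      rule exI[of _ i], rule exI[of _ u], intro conjI)
    show "\<alpha> \<in> {gen_a, gen_A}" by fact
    show "\<forall>j\<in>{1..m}. i j \<in> {0..k - 1}"
      using assms by (simp add: i_def less_Suc_eq_le[symmetric])
    show "m = 0 \<or> i m \<noteq> 0" using N by (auto simp: i_def dvd_eq_mod_eq_0)
    show "u = (\<Sum>j=1..m. of_nat (i j) / of_nat k ^ j) + of_nat s" by (fact u_def)
    show "g = elt k [gen_b] [^]\<^bsub>BS k\<^esub> (t - int m) \<otimes>\<^bsub>BS k\<^esub> a_pow k (if \<alpha> = gen_a then u else - u)"
      by (fact g_def)
    show "w = b_word (t - int m + int m) @
        concat (map (\<lambda>j. replicate (i j) \<alpha> @ [gen_B]) (rev [1..<Suc m])) @ replicate s \<alpha>"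
      unfolding w nf_word_def nf_digits_def rev_upt_eq map_map o_def s_def i_def
      by (auto intro!: arg_cong[of _ _ concat])
  qed
  ultimately show "w \<in> NF k" unfolding NF_def by blast
qed

lemma height_b_word [simp]: "height (b_word t) = - t"
  by (simp add: b_word_def)

lemma val_b_word [simp]: "val k h (b_word t) = 0"
  by (auto simp: b_word_def intro: val_eq_0 split: if_splits)

text \<open>The lowest digit is read at height \<open>h\<close> and the digits of
  \<open>N div k\<close> from height \<open>h + 1\<close> on; together they give \<open>N\<close>
  times \<open>k^h\<close>.\<close>

lemma nf_digits_height_val:
  assumes "k > 0" "\<alpha> \<in> {gen_a, gen_A}"
  shows "height (nf_digits k \<alpha> gen_B N 0 m) = int m \<and>
    val k h (nf_digits k \<alpha> gen_B N 0 m) = letter_value \<alpha> * real N * real k powi h"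
proof (induction m arbitrary: N h)
  case 0
  show ?case using assms(2) by (auto simp: nf_digits_def val_replicate)
next
  case (Suc m)
  have "letter_height \<alpha> = 0" using assms(2) by auto
  moreover have "real N = real k * real (N div k) + real (N mod k)"
    by (metis mult_div_mod_eq of_nat_add of_nat_mult)
  ultimately show ?case
    using Suc.IH[of "N div k" "h + 1"] assms(1)
    by (simp add: nf_digits_0 val_replicate power_int_add algebra_simps)
qed

lemma height_nf_word [simp]:
  "k > 0 \<Longrightarrow> \<alpha> \<in> {gen_a, gen_A} \<Longrightarrow> height (nf_word k t \<alpha> N m) = int m - t"
  by (simp add: nf_word_def nf_digits_height_val del: insert_iff)

lemma val_nf_word:
  "k > 0 \<Longrightarrow> \<alpha> \<in> {gen_a, gen_A} \<Longrightarrow>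
   val k h (nf_word k t \<alpha> N m) = letter_value \<alpha> * real N * real k powi (h - t)"
  by (simp add: nf_word_def nf_digits_height_val del: insert_iff)

section \<open>Finite automata and letter-by-letter tables\<close>

lemma nfa_path_snoc: "nfa_path \<Delta> p w q \<Longrightarrow> (q, x, r) \<in> \<Delta> \<Longrightarrow> nfa_path \<Delta> p (w @ [x]) r"
  by (induction rule: nfa_path.induct) (auto intro: nfa_path.intros)

lemma nfa_path_map_state:
  "nfa_path \<Delta> p w q \<Longrightarrow> nfa_path ((\<lambda>(p, x, q). (e p, x, e q)) ` \<Delta>) (e p) w (e q)"
  by (induction rule: nfa_path.induct) (force intro: nfa_path.intros)+

text \<open>Injectivity of \<open>e\<close> makes consecutive renamed transitions agree on the
  original state between them.\<close>

lemma nfa_path_unmap_state: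
  assumes "nfa_path ((\<lambda>(p, x, q). (e p, x, e q)) ` \<Delta>) p' w q'"
    and "inj_on e Q" "\<Delta> \<subseteq> Q \<times> S \<times> Q" "p \<in> Q" "p' = e p"
  shows "\<exists>q\<in>Q. q' = e q \<and> nfa_path \<Delta> p w q"
  using assms(1,4,5)
proof (induction arbitrary: p rule: nfa_path.induct)
  case (nfa_path_Nil p')
  then show ?case using nfa_path.nfa_path_Nil[of \<Delta> p] by blast
next
  case (nfa_path_Cons p' x q' w r')
  then obtain p\<^sub>1 q where "(p\<^sub>1, x, q) \<in> \<Delta>" "p' = e p\<^sub>1" "q' = e q" by auto
  moreover from this assms(3) have "p\<^sub>1 \<in> Q" "q \<in> Q" by auto
  moreover from calculation nfa_path_Cons.prems have "p\<^sub>1 = p"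
    using inj_onD[OF assms(2)] by metis
  moreover obtain r where "r \<in> Q" "r' = e r" "nfa_path \<Delta> q w r"
    using nfa_path_Cons.IH[OF \<open>q \<in> Q\<close> \<open>q' = e q\<close>] by blast
  ultimately show ?case
    using nfa_path.nfa_path_Cons[of p x q \<Delta> w r] by blast
qed

text \<open>Permits states of any type: \<open>regular_over\<close> asks for natural numbers, so the
  finitely many states are renamed injectively.\<close>

lemma regular_overI:
  assumes "finite Q" "\<Delta> \<subseteq> Q \<times> S \<times> Q" "q\<^sub>0 \<in> Q" "F \<subseteq> Q"
  shows "regular_over S {w. \<exists>f\<in>F. nfa_path \<Delta> q\<^sub>0 w f}"
proof -
  obtain e :: "_ \<Rightarrow> nat" where e: "inj_on e Q"
    using finite_imp_inj_to_nat_seg[OF assms(1)] by blast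
  let ?\<Delta> = "(\<lambda>(p, x, q). (e p, x, e q)) ` \<Delta>"
  have "{w. \<exists>f\<in>F. nfa_path \<Delta> q\<^sub>0 w f} = {w. \<exists>f\<in>e ` F. nfa_path ?\<Delta> (e q\<^sub>0) w f}"
  proof (intro Collect_cong iffI)
    fix w assume "\<exists>f\<in>F. nfa_path \<Delta> q\<^sub>0 w f"
    then show "\<exists>f\<in>e ` F. nfa_path ?\<Delta> (e q\<^sub>0) w f" using nfa_path_map_state by fast
  next
    fix w assume "\<exists>f\<in>e ` F. nfa_path ?\<Delta> (e q\<^sub>0) w f"
    then obtain f where f: "f \<in> F" "nfa_path ?\<Delta> (e q\<^sub>0) w (e f)" by blast
    then obtain q where "q \<in> Q" "e f = e q" "nfa_path \<Delta> q\<^sub>0 w q"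
      using nfa_path_unmap_state[OF f(2) e assms(2,3) refl] by blast
    with f(1) assms(4) e show "\<exists>f\<in>F. nfa_path \<Delta> q\<^sub>0 w f" by (metis inj_onD subsetD)
  qed
  moreover have "?\<Delta> \<subseteq> e ` Q \<times> S \<times> e ` Q" using assms(2) by auto
  ultimately show ?thesis
    unfolding regular_over_def using assms
    by (intro exI[of _ "e ` Q"] exI[of _ ?\<Delta>] exI[of _ "e q\<^sub>0"] exI[of _ "e ` F"]) auto
qed

definition substitution :: "('v \<Rightarrow> 'v list) \<Rightarrow> 'v list \<Rightarrow> 'v list" where
  "substitution f w = concat (map f w)"

lemma substitution_simps [simp]:
  "substitution f [] = []"
  "substitution f (x # w) = f x @ substitution f w"
  "substitution f (u @ w) = substitution f u @ substitution f w"
  by (simp_all add: substitution_def)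

lemma free_monoid_endo_substitution:
  assumes "\<And>x. x \<in> V \<Longrightarrow> set (f x) \<subseteq> V"
  shows "free_monoid_endo V (substitution f)"
  using assms unfolding free_monoid_endo_def
  by (force simp: substitution_def in_lists_conv_set)

lemma substitution_replicate:
  "f x = replicate c y \<Longrightarrow> substitution f (replicate n x) = replicate (n * c) y"
  by (induction n) (simp_all add: replicate_add)

section \<open>Prefixes of a number, seen from a moving bottom height\<close>

text \<open>Heights are counted from the current bottom, and \<open>v\<close> is the prefix of the number that lies
  above it. \<open>Live\<close> means that the bottom has not passed below \<open>P\<close>, and \<open>Done\<close> that it has
  passed below \<open>L\<close>. In between it is recorded whether the last digit is zero, since the digit at
  height \<open>L\<close> must not be.\<close>

datatype phase = Live | Zero_Digit | Nonzero_Digit | Done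

instance phase :: finite
proof
  have "UNIV = {Live, Zero_Digit, Nonzero_Digit, Done}" using phase.exhaust by blast
  then show "finite (UNIV :: phase set)" by (metis finite.simps)
qed

text \<open>Relative heights are cut off at \<open>0\<close>: \<open>P = 0\<close> means that the
  bottom is still at or above the top height, \<open>L = 0\<close> that it is at or above the lowest
  height.\<close>

definition phase_of :: "nat \<Rightarrow> nat \<Rightarrow> nat \<Rightarrow> nat \<Rightarrow> phase" where
  "phase_of k v P L =
     (if P = 0 then Live else if L > 0 then Done else if k dvd v then Zero_Digit else Nonzero_Digit)"

text \<open>Positions below \<open>L\<close> carry zeros. The digit at \<open>L\<close> must be
  nonzero if a digit is written at all (\<open>L < P\<close>), but this is demanded only after the
  bottom has passed it (\<open>0 < L\<close>).\<close>

definition admissible :: "nat \<Rightarrow> nat \<Rightarrow> nat \<Rightarrow> nat \<Rightarrow> bool" where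
  "admissible k v P L \<longleftrightarrow> L \<le> P \<and> k ^ L dvd v \<and> (0 < L \<and> L < P \<longrightarrow> \<not> k ^ Suc L dvd v)"

text \<open>\<open>Live\<close> may go directly to \<open>Done\<close>, which is the case of no
  written digit (\<open>m = 0\<close>). \<open>Zero_Digit\<close> may not, since the lowest written
  digit must be nonzero.\<close>

fun phase_step :: "phase \<Rightarrow> nat \<Rightarrow> phase \<Rightarrow> bool" where
  "phase_step p d Live \<longleftrightarrow> p = Live"
| "phase_step p d Zero_Digit \<longleftrightarrow> d = 0 \<and> p \<noteq> Done"
| "phase_step p d Nonzero_Digit \<longleftrightarrow> d \<noteq> 0 \<and> p \<noteq> Done"
| "phase_step p d Done \<longleftrightarrow> d = 0 \<and> p \<noteq> Zero_Digit"

text \<open>One level back, the last digit is dropped; truncated subtraction keeps heights not yet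
  passed at \<open>0\<close>.\<close>

lemma admissible_pred:
  assumes "k > 0" "admissible k v P L"
  shows "admissible k (v div k) (P - 1) (L - 1)"
    and "phase_step (phase_of k (v div k) (P - 1) (L - 1)) (v mod k) (phase_of k v P L)"
proof -
  have LP: "L \<le> P" and dvd: "k ^ L dvd v" and ndvd: "0 < L \<Longrightarrow> L < P \<Longrightarrow> \<not> k ^ Suc L dvd v"
    using assms(2) by (auto simp: admissible_def)
  have "admissible k (v div k) (P - 1) (L - 1) \<and>
    phase_step (phase_of k (v div k) (P - 1) (L - 1)) (v mod k) (phase_of k v P L)"
  proof (cases L)
    case 0
    then show ?thesis
      using LP by (auto simp: admissible_def phase_of_def dvd_eq_mod_eq_0)
  next
    case (Suc l)
    with dvd have "k dvd v" by (meson dvd_power dvd_trans zero_less_Suc)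
    then obtain u where u: "v = k * u" by auto
    \<comment> \<open>For \<open>l = 0\<close> the bottom has just passed the lowest height, so the
      preceding phase is \<open>Live\<close> or \<open>Nonzero_Digit\<close>.\<close>
    with Suc dvd ndvd LP assms(1) show ?thesis
      by (cases l) (auto simp: admissible_def phase_of_def)
  qed
  then show "admissible k (v div k) (P - 1) (L - 1)"
    and "phase_step (phase_of k (v div k) (P - 1) (L - 1)) (v mod k) (phase_of k v P L)" by auto
qed

text \<open>Converse of \<open>admissible_pred\<close>. If \<open>P = 0\<close>, then
  \<open>P' - 1 = P\<close> allows both \<open>P' = 0\<close> and \<open>P' = 1\<close>, and
  likewise for \<open>L\<close>; the target phase \<open>p\<close> decides.\<close>

lemma admissible_succ:
  assumes "k > 0" "admissible k v P L" "d < k" "phase_step (phase_of k v P L) d p"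
  shows "\<exists>P' L'. P' - 1 = P \<and> L' - 1 = L \<and> admissible k (k * v + d) P' L' \<and>
    phase_of k (k * v + d) P' L' = p"
proof -
  have LP: "L \<le> P" and dvd: "k ^ L dvd v" and ndvd: "0 < L \<Longrightarrow> L < P \<Longrightarrow> \<not> k ^ Suc L dvd v"
    using assms(2) by (auto simp: admissible_def)
  have k_dvd: "k dvd k * v + d \<longleftrightarrow> d = 0"
    using assms(3) by (simp add: dvd_add_right_iff nat_dvd_not_less) (use nat_dvd_not_less in blast)
  show ?thesis
  proof (cases p)
    case Live
    then have "P = 0" "L = 0"
      using assms(4) LP by (auto simp: phase_of_def split: if_splits)
    then show ?thesis using Live
      by (intro exI[of _ 0]) (simp add: admissible_def phase_of_def)
  next
    case Zero_Digit
    then have "L = 0" "d = 0"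
      using assms(4) LP by (auto simp: phase_of_def split: if_splits)
    then show ?thesis using Zero_Digit
      by (intro exI[of _ "Suc P"] exI[of _ 0]) (simp add: admissible_def phase_of_def)
  next
    case Nonzero_Digit
    then have "L = 0" "d \<noteq> 0"
      using assms(4) LP by (auto simp: phase_of_def split: if_splits)
    then show ?thesis using Nonzero_Digit k_dvd
      by (intro exI[of _ "Suc P"] exI[of _ 0]) (simp add: admissible_def phase_of_def)
  next
    case Done
    then have "d = 0" "L = 0 \<Longrightarrow> P = 0 \<or> \<not> k dvd v"
      using assms(4) by (auto simp: phase_of_def split: if_splits)
    then have "admissible k (k * v) (Suc P) (Suc L)"
      using LP dvd ndvd assms(1) by (cases L) (auto simp: admissible_def)
    with Done \<open>d = 0\<close> show ?thesis
      by (intro exI[of _ "Suc P"] exI[of _ "Suc L"]) (simp add: phase_of_def)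
  qed
qed

section \<open>The system\<close>

datatype comp = C1 | C2 | C3

instance comp :: finite
proof
  have "UNIV = {C1, C2, C3}" using comp.exhaust by blast
  then show "finite (UNIV :: comp set)" by (metis finite.simps)
qed

lemma UNIV_comp: "UNIV = {C1, C2, C3}"
  using comp.exhaust by blast

text \<open>Each normal form starts where its predecessor ends, and the first where the last ends.\<close>

fun prev :: "comp \<Rightarrow> comp" where
  "prev C1 = C3" | "prev C2 = C1" | "prev C3 = C2"

text \<open>\<open>slot i\<close> is the position in normal form \<open>i\<close> at which the word grows, and \<open>mark i\<close> stands
  for its letter \<open>a\<close> or \<open>A\<close>.\<close>

fun slot :: "comp \<Rightarrow> symbol + nat" where
  "slot C1 = Inr 0" | "slot C2 = Inr 1" | "slot C3 = Inr 2"

fun mark :: "comp \<Rightarrow> symbol + nat" where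
  "mark C1 = Inr 3" | "mark C2 = Inr 4" | "mark C3 = Inr 5"

definition alphabet :: "(symbol + nat) set" where
  "alphabet = range Inl \<union> range slot \<union> range mark"

abbreviation letters :: "letter list \<Rightarrow> (symbol + nat) list" where
  "letters w \<equiv> map (\<lambda>x. Inl (Gen x)) w"

definition slot_mark_map :: "(comp \<Rightarrow> (symbol + nat) list) \<Rightarrow> (comp \<Rightarrow> (symbol + nat) list) \<Rightarrow>
    symbol + nat \<Rightarrow> (symbol + nat) list" where
  "slot_mark_map f g x =
     (if x = slot C1 then f C1 else if x = slot C2 then f C2 else if x = slot C3 then f C3
      else if x = mark C1 then g C1 else if x = mark C2 then g C2 else if x = mark C3 then g C3
      else [x])"

lemma slot_mark_map_simps [simp]:
  "slot_mark_map f g (Inl s) = [Inl s]"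
  "slot_mark_map f g (slot i) = f i"
  "slot_mark_map f g (mark i) = g i"
proof -
  show "slot_mark_map f g (Inl s) = [Inl s]" by (simp add: slot_mark_map_def)
  show "slot_mark_map f g (slot i) = f i" "slot_mark_map f g (mark i) = g i"
    by (cases i; simp add: slot_mark_map_def)+
qed

text \<open>Keeps \<open>slot i\<close> and \<open>mark i\<close> opaque, so that
  \<open>slot_mark_map_simps\<close> applies to every component.\<close>

declare slot.simps [simp del] mark.simps [simp del]

text \<open>\<open>p\<close> holds the phases after the step. Left of the slot stands the power of
  \<open>b\<close> with exponent \<open>P (prev i) - L i\<close>; each of these heights grows only
  once it is passed, so a letter is added when exactly one of them grows. The new digit goes
  directly after the slot because lower digits stand further left.\<close>

definition slot_image :: "(comp \<Rightarrow> phase) \<Rightarrow> (comp \<Rightarrow> nat) \<Rightarrow> comp \<Rightarrow> (symbol + nat) list" where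
  "slot_image p d i =
     letters ((if p (prev i) \<noteq> Live \<and> p i \<noteq> Done then [gen_b] else []) @
              (if p (prev i) = Live \<and> p i = Done then [gen_B] else [])) @
     [slot i] @ replicate (d i) (mark i) @
     letters (if p i \<in> {Zero_Digit, Nonzero_Digit} then [gen_B] else [])"

definition level_table :: "nat \<Rightarrow> (comp \<Rightarrow> phase) \<Rightarrow> (comp \<Rightarrow> nat) \<Rightarrow>
    (symbol + nat) list \<Rightarrow> (symbol + nat) list" where
  "level_table k p d = substitution
     (slot_mark_map (slot_image p d) (\<lambda>i. replicate (if p i = Live then k else 1) (mark i)))"

definition signed_gen :: "bool \<Rightarrow> letter" where
  "signed_gen s = (if s then gen_a else gen_A)"

definition final_table :: "(comp \<Rightarrow> bool) \<Rightarrow> (symbol + nat) list \<Rightarrow> (symbol + nat) list" where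
  "final_table \<sigma> = substitution (slot_mark_map (\<lambda>i. []) (\<lambda>i. letters [signed_gen (\<sigma> i)]))"

definition start_word :: "(symbol + nat) list" where
  "start_word = [slot C1, Inl Hash, slot C2, Inl Hash, slot C3]"

definition signed_sum :: "(comp \<Rightarrow> bool) \<Rightarrow> (comp \<Rightarrow> nat) \<Rightarrow> int" where
  "signed_sum \<sigma> v = (\<Sum>i\<in>UNIV. (if \<sigma> i then 1 else - 1) * int (v i))"

datatype state = Start | Run "comp \<Rightarrow> bool" "comp \<Rightarrow> phase" int | Stop

text \<open>The signs \<sigma> are guessed at the start and written only by the last table. The
  number \<open>c\<close> is the signed sum of the prefixes; its bounds keep the states
  finite.\<close>

inductive move :: "nat \<Rightarrow> state \<Rightarrow> ((symbol + nat) list \<Rightarrow> (symbol + nat) list) \<Rightarrow> state \<Rightarrow> bool"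
  for k where
  move_init: "move k Start id (Run \<sigma> (\<lambda>i. Live) 0)"
| move_level: "\<bar>c\<bar> \<le> 3 \<Longrightarrow> \<bar>int k * c + signed_sum \<sigma> d\<bar> \<le> 3 \<Longrightarrow> (\<And>i. d i < k) \<Longrightarrow>
    (\<And>i. phase_step (p i) (d i) (p' i)) \<Longrightarrow>
    move k (Run \<sigma> p c) (level_table k p' d) (Run \<sigma> p' (int k * c + signed_sum \<sigma> d))"
| move_final: "move k (Run \<sigma> (\<lambda>i. Done) 0) (final_table \<sigma>) Stop"

definition moves :: "nat \<Rightarrow> (state \<times> ((symbol + nat) list \<Rightarrow> (symbol + nat) list) \<times> state) set" where
  "moves k = {(q, \<tau>, q'). move k q \<tau> q'}"

definition states :: "state set" where
  "states = {Start, Stop} \<union> (\<lambda>(\<sigma>, p, c). Run \<sigma> p c) ` (UNIV \<times> UNIV \<times> {-3..3})"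

definition tables :: "nat \<Rightarrow> ((symbol + nat) list \<Rightarrow> (symbol + nat) list) set" where
  "tables k = {id} \<union> (\<lambda>(p, d). level_table k p d) ` (UNIV \<times> {d. \<forall>i. d i < k}) \<union> range final_table"

definition control :: "nat \<Rightarrow> ((symbol + nat) list \<Rightarrow> (symbol + nat) list) list set" where
  "control k = {r. \<exists>f\<in>{Stop}. nfa_path (moves k) Start r f}"

section \<open>Finiteness of the system\<close>

lemma finite_digits: "finite {d :: comp \<Rightarrow> nat. \<forall>i. d i < k}"
proof -
  have "{d :: comp \<Rightarrow> nat. \<forall>i. d i < k} = {d. \<forall>i. (i \<in> UNIV \<longrightarrow> d i \<in> {..<k}) \<and> (i \<notin> UNIV \<longrightarrow> d i = 0)}"
    by auto
  then show ?thesis using finite_set_of_finite_funs[of "UNIV :: comp set" "{..<k}" 0] by simp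
qed

lemma finite_symbol: "finite (UNIV :: symbol set)"
proof (rule finite_subset)
  show "UNIV \<subseteq> {Hash, Gen gen_a, Gen gen_A, Gen gen_b, Gen gen_B}"
  proof
    fix x :: symbol
    show "x \<in> {Hash, Gen gen_a, Gen gen_A, Gen gen_b, Gen gen_B}"
    proof (cases x)
      case (Gen y)
      then show ?thesis by (cases y) simp_all
    qed simp
  qed
qed simp

lemma alphabet_simps [simp]:
  "Inl s \<in> alphabet" "slot i \<in> alphabet" "mark i \<in> alphabet"
  by (simp_all add: alphabet_def)

lemma free_monoid_endo_slot_mark_map:
  assumes "\<And>i. set (f i) \<subseteq> alphabet" "\<And>i. set (g i) \<subseteq> alphabet"
  shows "free_monoid_endo alphabet (substitution (slot_mark_map f g))"
proof (rule free_monoid_endo_substitution)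
  fix x assume "x \<in> alphabet"
  then consider s where "x = Inl s" | i where "x = slot i" | i where "x = mark i"
    by (auto simp: alphabet_def)
  then show "set (slot_mark_map f g x) \<subseteq> alphabet"
    using assms by cases simp_all
qed

lemma edt0l_system_control:
  "edt0l_system alphabet (range Inl) (control k) start_word"
  unfolding edt0l_system_def
proof (intro conjI exI)
  show "finite alphabet"
    using finite_symbol by (simp add: alphabet_def)
  show "range Inl \<subseteq> alphabet" by auto
  show "start_word \<in> lists alphabet" by (simp add: start_word_def)
  show "finite (tables k)"
    using finite_digits by (simp add: tables_def)
  have "free_monoid_endo alphabet (level_table k p d)" for p d
    unfolding level_table_def
    by (rule free_monoid_endo_slot_mark_map) (auto simp: slot_image_def)
  moreover have "free_monoid_endo alphabet (final_table \<sigma>)" for \<sigma>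
    unfolding final_table_def by (rule free_monoid_endo_slot_mark_map) auto
  moreover have "free_monoid_endo alphabet id" by (simp add: free_monoid_endo_def)
  ultimately show "\<forall>\<tau>\<in>tables k. free_monoid_endo alphabet \<tau>"
    by (auto simp: tables_def)
  show "regular_over (tables k) (control k)"
    unfolding control_def
  proof (rule regular_overI)
    show "finite states" by (simp add: states_def)
    have "q \<in> states \<and> \<tau> \<in> tables k \<and> q' \<in> states" if "move k q \<tau> q'" for q \<tau> q'
      using that
    proof cases
      case (move_level c \<sigma> d p p')
      have "Run \<sigma>' p'' c' \<in> states" if "\<bar>c'\<bar> \<le> 3" for \<sigma>' p'' c'
        using that unfolding states_def by (intro UnI2 image_eqI[of _ _ "(\<sigma>', p'', c')"]) auto
      moreover have "level_table k p' d \<in> tables k"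
        using move_level unfolding tables_def
        by (intro UnI1 UnI2 image_eqI[of _ _ "(p', d)"]) auto
      ultimately show ?thesis using move_level by blast
    qed (force simp: states_def tables_def)+
    then show "moves k \<subseteq> states \<times> tables k \<times> states"
      unfolding moves_def by blast
  qed (auto simp: states_def)
qed

section \<open>The words the system derives\<close>

text \<open>The exponent of \<open>b\<close> is a descent: from \<open>P (prev i)\<close>, where the
  preceding normal form ends, to the lowest height \<open>L i\<close>.\<close>

definition component :: "nat \<Rightarrow> (comp \<Rightarrow> nat) \<Rightarrow> (comp \<Rightarrow> nat) \<Rightarrow> (comp \<Rightarrow> nat) \<Rightarrow> comp \<Rightarrow>
    (symbol + nat) list" where
  "component k v P L i = letters (b_word (int (P (prev i)) - int (L i))) @ slot i #
     nf_digits k (mark i) (Inl (Gen gen_B)) (v i) (L i) (P i)"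

definition configuration :: "nat \<Rightarrow> (comp \<Rightarrow> nat) \<Rightarrow> (comp \<Rightarrow> nat) \<Rightarrow> (comp \<Rightarrow> nat) \<Rightarrow>
    (symbol + nat) list" where
  "configuration k v P L =
     component k v P L C1 @ [Inl Hash] @ component k v P L C2 @ [Inl Hash] @ component k v P L C3"

section \<open>Effect of a level table on a configuration\<close>

lemma substitution_letters [simp]: "substitution (slot_mark_map f g) (letters w) = letters w"
  by (induction w) auto

lemma substitution_nf_digits:
  assumes "f x = replicate c x'" "f y = [y']"
  shows "substitution f (nf_digits k x y N l m) =
    concat (map (\<lambda>j. replicate (N div k ^ j mod k * c) x' @ [y']) [l..<m]) @
    replicate (N div k ^ m * c) x'"
proof -
  have "substitution f (concat (map (\<lambda>j. replicate (N div k ^ j mod k) x @ [y]) js)) =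
      concat (map (\<lambda>j. replicate (N div k ^ j mod k * c) x' @ [y']) js)" for js
    using assms by (induction js) (simp_all add: substitution_replicate)
  then show ?thesis using assms by (simp add: nf_digits_def substitution_replicate)
qed

text \<open>When \<open>b\<close> is added the old exponent is nonnegative, and when
  \<open>B\<close> is added it is nonpositive, so the new letter never meets its inverse.\<close>

lemma b_word_step:
  "b_word (int (Q - 1) - int (L - 1)) @
     (if Q \<noteq> 0 \<and> L = 0 then [gen_b] else []) @ (if Q = 0 \<and> L \<noteq> 0 then [gen_B] else []) =
   b_word (int Q - int L)"
proof -
  have "replicate (nat (int n + 1)) x = replicate n x @ [x]" for n and x :: letter
    by (simp add: nat_add_distrib replicate_append_same)
  then show ?thesis
    by (cases Q; cases L) (auto simp: b_word_def nat_add_distrib replicate_append_same)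
qed

text \<open>A level step undoes dropping the last digit. Below \<open>L i\<close> nothing is written
  for the digit, and \<open>admissible\<close> guarantees that it is zero.\<close>

lemma level_table_component:
  assumes k: "k > 0" and adm: "\<And>i. admissible k (v i) (P i) (L i)"
  shows "level_table k (\<lambda>i. phase_of k (v i) (P i) (L i)) (\<lambda>i. v i mod k)
      (component k (\<lambda>i. v i div k) (\<lambda>i. P i - 1) (\<lambda>i. L i - 1) i) = component k v P L i"
    (is "level_table k ?p ?d _ = _")
proof -
  have LP: "L i \<le> P i" for i using adm by (simp add: admissible_def)
  have live: "?p i = Live \<longleftrightarrow> P i = 0" for i by (simp add: phase_of_def)
  have is_done: "?p i = Done \<longleftrightarrow> L i \<noteq> 0" for i using LP[of i] by (auto simp: phase_of_def)
  let ?\<tau> = "slot_mark_map (slot_image ?p ?d) (\<lambda>i. replicate (if ?p i = Live then k else 1) (mark i))"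
  let ?B = "Inl (Gen gen_B) :: symbol + nat"
  have digits: "replicate (?d i) (mark i) @
      letters (if ?p i \<in> {Zero_Digit, Nonzero_Digit} then [gen_B] else []) @
      substitution ?\<tau> (nf_digits k (mark i) ?B (v i div k) (L i - 1) (P i - 1)) =
      nf_digits k (mark i) ?B (v i) (L i) (P i)"
  proof (cases "P i = 0")
    \<comment> \<open>The whole number is still unary: each mark becomes \<open>k\<close> marks and
      the digit is added.\<close>
    case True
    then have "?p i = Live" by (simp add: phase_of_def)
    moreover have "L i = 0" using LP[of i] True by simp
    moreover have "substitution ?\<tau> (replicate n (mark i)) = replicate (n * k) (mark i)" for n
      using \<open>?p i = Live\<close> by (intro substitution_replicate) simp
    ultimately show ?thesis
      using True by (simp add: nf_digits_def flip: replicate_add)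
  next
    case False
    \<comment> \<open>Once \<open>P i\<close> is passed, marks are no longer multiplied, so what is
      already written stays.\<close>
    have fixed: "substitution ?\<tau> (nf_digits k (mark i) ?B N l m) = nf_digits k (mark i) ?B N l m"
      for N l m
      using substitution_nf_digits[of ?\<tau> "mark i" 1 "mark i" ?B ?B k N l m] False
      by (simp add: live nf_digits_def)
    show ?thesis
    proof (cases "L i")
      case 0
      then have "?p i \<in> {Zero_Digit, Nonzero_Digit}"
        using False by (simp add: phase_of_def)
      with 0 False show ?thesis by (simp only: fixed) (simp add: nf_digits_0)
    next
      case (Suc l)
      then have "?p i = Done" using is_done[of i] by (metis nat.distinct(1))
      moreover have "v i mod k = 0" using adm[of i] Suc
        by (auto simp: admissible_def dvd_eq_mod_eq_0[symmetric] intro: dvd_mult_left)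
      moreover obtain m where "P i = Suc m" using False by (cases "P i") auto
      ultimately show ?thesis using Suc by (simp only: fixed) (simp add: nf_digits_Suc)
    qed
  qed
  have "substitution ?\<tau> (component k (\<lambda>i. v i div k) (\<lambda>i. P i - 1) (\<lambda>i. L i - 1) i) =
    letters (b_word (int (P (prev i) - 1) - int (L i - 1)) @
      (if P (prev i) \<noteq> 0 \<and> L i = 0 then [gen_b] else []) @
      (if P (prev i) = 0 \<and> L i \<noteq> 0 then [gen_B] else [])) @
    slot i # nf_digits k (mark i) ?B (v i) (L i) (P i)"
    unfolding digits[symmetric] by (simp add: component_def slot_image_def live is_done)
  then show ?thesis
    by (simp only: level_table_def b_word_step component_def simp_thms)
qed

lemma level_table_append: "level_table k p d (u @ w) = level_table k p d u @ level_table k p d w"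
  by (simp add: level_table_def)

lemma level_table_configuration:
  assumes "k > 0" "\<And>i. admissible k (v i) (P i) (L i)"
  shows "level_table k (\<lambda>i. phase_of k (v i) (P i) (L i)) (\<lambda>i. v i mod k)
      (configuration k (\<lambda>i. v i div k) (\<lambda>i. P i - 1) (\<lambda>i. L i - 1)) = configuration k v P L"
proof -
  have "level_table k p d [Inl Hash] = [Inl Hash]" for p d
    by (simp add: level_table_def)
  then show ?thesis
    unfolding configuration_def level_table_append
    by (simp only: level_table_component[where v = v and P = P and L = L, OF assms])
qed

lemma start_word_eq: "start_word = configuration k (\<lambda>i. 0) (\<lambda>i. 0) (\<lambda>i. 0)"
  by (simp add: start_word_def configuration_def component_def nf_digits_def b_word_def)

section \<open>Bounds on the signed sum\<close>

lemma signed_sum_Horner: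
  "signed_sum \<sigma> (\<lambda>i. k * v i + d i) = int k * signed_sum \<sigma> v + signed_sum \<sigma> d"
  by (simp add: signed_sum_def UNIV_comp algebra_simps)

lemma signed_sum_div_mod:
  "signed_sum \<sigma> v = int k * signed_sum \<sigma> (\<lambda>i. v i div k) + signed_sum \<sigma> (\<lambda>i. v i mod k)"
  by (simp flip: signed_sum_Horner)

lemma abs_signed_sum_le:
  assumes "k > 0" "\<And>i. d i < k" shows "\<bar>signed_sum \<sigma> d\<bar> \<le> 3 * (int k - 1)"
proof -
  have "int (d i) \<le> int k - 1" for i using assms(2)[of i] by simp
  from this[of C1] this[of C2] this[of C3] show ?thesis
    by (auto simp: signed_sum_def UNIV_comp)
qed

text \<open>The last digits contribute at most \<open>3 (k - 1)\<close> in absolute value, so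
  \<open>k\<close> times the sum of the shorter prefixes is at most \<open>3 k\<close>. Going back
  from the final sum \<open>0\<close>, all prefix sums stay in range.\<close>

lemma signed_sum_div_bound:
  assumes "k > 0" "\<bar>signed_sum \<sigma> v\<bar> \<le> 3"
  shows "\<bar>signed_sum \<sigma> (\<lambda>i. v i div k)\<bar> \<le> 3"
proof -
  have bound: "\<bar>x\<bar> \<le> n * 3" if "y = x + z" "\<bar>y\<bar> \<le> 3" "\<bar>z\<bar> \<le> 3 * (n - 1)" for x y z n :: int
    using that by arith
  have "\<bar>signed_sum \<sigma> (\<lambda>i. v i mod k)\<bar> \<le> 3 * (int k - 1)"
    using assms(1) by (intro abs_signed_sum_le) auto
  then have "\<bar>int k * signed_sum \<sigma> (\<lambda>i. v i div k)\<bar> \<le> int k * 3"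
    using bound[OF signed_sum_div_mod assms(2)] by blast
  then show ?thesis using assms(1) by (simp add: abs_mult)
qed

text \<open>Completeness: the run for the numbers without their last digits is extended by one level
  table. \<open>P i\<close> belongs to the measure because division by \<open>k\<close> does not
  decrease \<open>v i = 0\<close>.\<close>

lemma configuration_reachable:
  assumes "k \<ge> 2"
  shows "(\<And>i. admissible k (v i) (P i) (L i)) \<Longrightarrow> \<bar>signed_sum \<sigma> v\<bar> \<le> 3 \<Longrightarrow>
    \<exists>r. nfa_path (moves k) Start r (Run \<sigma> (\<lambda>i. phase_of k (v i) (P i) (L i)) (signed_sum \<sigma> v)) \<and>
        fold (\<lambda>\<tau> x. \<tau> x) r start_word = configuration k v P L"
proof (induction "\<Sum>i\<in>UNIV. v i + P i" arbitrary: v P L rule: less_induct)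
  case less
  note adm = less.prems(1)
  have k: "k > 0" using assms by simp
  have LP: "L i \<le> P i" for i using adm by (simp add: admissible_def)
  show ?case
  proof (cases "\<forall>i. v i = 0 \<and> P i = 0")
    case True
    then have zero: "v = (\<lambda>i. 0)" "P = (\<lambda>i. 0)" "L = (\<lambda>i. 0)" using LP by auto
    have "(Start, id, Run \<sigma> (\<lambda>i. Live) 0) \<in> moves k"
      by (simp add: moves_def move_init)
    then have "nfa_path (moves k) Start [id] (Run \<sigma> (\<lambda>i. Live) 0)"
      by (auto intro: nfa_path.intros)
    then show ?thesis
      unfolding zero
      by (intro exI[of _ "[id]"]) (simp add: phase_of_def signed_sum_def flip: start_word_eq)
  next
    case False
    define v' where "v' i = v i div k" for i
    define P' where "P' i = P i - 1" for i
    define L' where "L' i = L i - 1" for i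
    have le: "v' i + P' i \<le> v i + P i" for i by (simp add: v'_def P'_def add_mono)
    obtain i where i: "v i \<noteq> 0 \<or> P i \<noteq> 0" using False by blast
    have "v' i + P' i < v i + P i"
    proof (cases "v i = 0")
      case True
      with i show ?thesis by (simp add: v'_def P'_def)
    next
      case False
      then have "v' i < v i" using assms by (simp add: v'_def)
      then show ?thesis by (simp add: P'_def)
    qed
    then have smaller: "(\<Sum>i\<in>UNIV. v' i + P' i) < (\<Sum>i\<in>UNIV. v i + P i)"
      using le by (intro sum_strict_mono_ex1) auto
    have adm': "admissible k (v' i) (P' i) (L' i)"
      and step: "phase_step (phase_of k (v' i) (P' i) (L' i)) (v i mod k) (phase_of k (v i) (P i) (L i))" for i
      using admissible_pred[OF k adm[of i]] by (simp_all add: v'_def P'_def L'_def)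
    have bound: "\<bar>signed_sum \<sigma> v'\<bar> \<le> 3"
      using signed_sum_div_bound[OF k less.prems(2)] by (simp add: v'_def[abs_def])
    obtain r where r: "nfa_path (moves k) Start r
          (Run \<sigma> (\<lambda>i. phase_of k (v' i) (P' i) (L' i)) (signed_sum \<sigma> v'))"
        "fold (\<lambda>\<tau> x. \<tau> x) r start_word = configuration k v' P' L'"
      using less.hyps[OF smaller adm' bound] by blast
    let ?p = "\<lambda>i. phase_of k (v i) (P i) (L i)"
    let ?\<tau> = "level_table k ?p (\<lambda>i. v i mod k)"
    have sum: "signed_sum \<sigma> v = int k * signed_sum \<sigma> v' + signed_sum \<sigma> (\<lambda>i. v i mod k)"
      using signed_sum_div_mod[of \<sigma> v k] by (simp add: v'_def[abs_def])
    have "(Run \<sigma> (\<lambda>i. phase_of k (v' i) (P' i) (L' i)) (signed_sum \<sigma> v'), ?\<tau>,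
        Run \<sigma> ?p (signed_sum \<sigma> v)) \<in> moves k"
      unfolding moves_def sum mem_Collect_eq prod.case
      using bound less.prems(2) step k by (intro move_level) (simp_all add: sum)
    from nfa_path_snoc[OF r(1) this]
    have "nfa_path (moves k) Start (r @ [?\<tau>]) (Run \<sigma> ?p (signed_sum \<sigma> v))" .
    moreover have "fold (\<lambda>\<tau> x. \<tau> x) (r @ [?\<tau>]) start_word = configuration k v P L"
      using r(2) level_table_configuration[of k v P L, OF k adm]
      by (simp add: v'_def[abs_def] P'_def[abs_def] L'_def[abs_def])
    ultimately show ?thesis by blast
  qed
qed

text \<open>For admissible arguments, \<open>L i > 0\<close> is equivalent to the phase
  \<open>Done\<close>.\<close>

definition derivable :: "nat \<Rightarrow> (symbol + nat) list \<Rightarrow> bool" where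
  "derivable k w \<longleftrightarrow> (\<exists>\<sigma> v P L. (\<forall>i. admissible k (v i) (P i) (L i) \<and> L i > 0) \<and>
     signed_sum \<sigma> v = 0 \<and> w = final_table \<sigma> (configuration k v P L))"

text \<open>Soundness: a state holds only signs, phases and the signed sum; the numbers and heights
  behind them are quantified existentially.\<close>

fun invariant :: "nat \<Rightarrow> state \<Rightarrow> (symbol + nat) list \<Rightarrow> bool" where
  "invariant k Start w \<longleftrightarrow> w = start_word"
| "invariant k (Run \<sigma> p c) w \<longleftrightarrow> (\<exists>v P L. (\<forall>i. admissible k (v i) (P i) (L i)) \<and>
     p = (\<lambda>i. phase_of k (v i) (P i) (L i)) \<and> c = signed_sum \<sigma> v \<and> w = configuration k v P L)"
| "invariant k Stop w \<longleftrightarrow> derivable k w"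

lemma invariant_move:
  assumes k: "k > 0"
  shows "move k q \<tau> q' \<Longrightarrow> invariant k q w \<Longrightarrow> invariant k q' (\<tau> w)"
proof (induction rule: move.induct)
  case (move_init \<sigma>)
  then show ?case
    by (auto simp: start_word_eq[of k] admissible_def phase_of_def signed_sum_def
        intro!: exI[of _ "\<lambda>i. 0"])
next
  case (move_level c \<sigma> d p p')
  then obtain v P L where adm: "\<And>i. admissible k (v i) (P i) (L i)"
    and p: "p = (\<lambda>i. phase_of k (v i) (P i) (L i))" and c: "c = signed_sum \<sigma> v"
    and w: "w = configuration k v P L" by auto
  define v' where "v' i = k * v i + d i" for i
  have d: "d i < k" for i by fact
  \<comment> \<open>The heights are not fixed in advance: the phases guessed by the automaton
    determine how they grow.\<close>
  have "\<forall>i. \<exists>P' L'. P' - 1 = P i \<and> L' - 1 = L i \<and> admissible k (v' i) P' L' \<and>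
      phase_of k (v' i) P' L' = p' i"
    unfolding v'_def using admissible_succ[OF k adm d] move_level.hyps(4) p by auto
  then obtain P' L' where new: "P' i - 1 = P i" "L' i - 1 = L i" "admissible k (v' i) (P' i) (L' i)"
      "phase_of k (v' i) (P' i) (L' i) = p' i" for i
    by metis
  have "v' i div k = v i" "v' i mod k = d i" for i using d[of i] by (simp_all add: v'_def)
  moreover have "(\<lambda>i. P' i - 1) = P" "(\<lambda>i. L' i - 1) = L" by (simp_all only: new(1,2))
  ultimately have "level_table k p' d w = configuration k v' P' L'"
    using level_table_configuration[of k v' P' L', OF k new(3)] by (simp only: new(4) w)
  moreover have "int k * c + signed_sum \<sigma> d = signed_sum \<sigma> v'"
    unfolding c v'_def[abs_def] signed_sum_Horner ..
  moreover have "p' = (\<lambda>i. phase_of k (v' i) (P' i) (L' i))" using new(4) by auto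
  ultimately show ?case unfolding invariant.simps using new(3) by blast
next
  case (move_final \<sigma>)
  then obtain v P L where adm: "\<forall>i. admissible k (v i) (P i) (L i)"
    and p: "(\<lambda>i. Done) = (\<lambda>i. phase_of k (v i) (P i) (L i))" and c: "0 = signed_sum \<sigma> v"
    and w: "w = configuration k v P L" by auto
  have "L i > 0" for i using fun_cong[OF p, of i] by (auto simp: phase_of_def split: if_splits)
  with adm c[symmetric] w show ?case unfolding invariant.simps derivable_def by blast
qed

lemma invariant_path:
  assumes "nfa_path (moves k) q r q'" "k > 0" "invariant k q w"
  shows "invariant k q' (fold (\<lambda>\<tau> x. \<tau> x) r w)"
  using assms(1,3)
  by (induction arbitrary: w) (auto simp: moves_def intro: invariant_move[OF assms(2)])

lemma derivable_iff:
  assumes "k \<ge> 2"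
  shows "(\<exists>r\<in>control k. w = fold (\<lambda>\<tau> x. \<tau> x) r start_word) \<longleftrightarrow> derivable k w"
proof
  assume "\<exists>r\<in>control k. w = fold (\<lambda>\<tau> x. \<tau> x) r start_word"
  then show "derivable k w"
    using invariant_path[of k Start _ Stop start_word] assms by (auto simp: control_def)
next
  assume "derivable k w"
  then obtain \<sigma> v P L where adm: "\<And>i. admissible k (v i) (P i) (L i)" and L: "\<And>i. L i > 0"
    and sum: "signed_sum \<sigma> v = 0" and w: "w = final_table \<sigma> (configuration k v P L)"
    unfolding derivable_def by blast
  have "P i > 0" for i using adm[of i] L[of i] by (simp add: admissible_def)
  then have "(\<lambda>i. phase_of k (v i) (P i) (L i)) = (\<lambda>i. Done)"
    using L by (auto simp: phase_of_def)
  with configuration_reachable[where v = v and P = P and L = L and \<sigma> = \<sigma>, OF assms adm] sum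
  obtain r where r: "nfa_path (moves k) Start r (Run \<sigma> (\<lambda>i. Done) 0)"
    "fold (\<lambda>\<tau> x. \<tau> x) r start_word = configuration k v P L" by auto
  have "(Run \<sigma> (\<lambda>i. Done) 0, final_table \<sigma>, Stop) \<in> moves k"
    by (simp add: moves_def move_final)
  from nfa_path_snoc[OF r(1) this] have "r @ [final_table \<sigma>] \<in> control k"
    by (simp add: control_def)
  then show "\<exists>r\<in>control k. w = fold (\<lambda>\<tau> x. \<tau> x) r start_word"
    using r(2) w by (intro bexI) auto
qed

section \<open>Triples of normal forms\<close>

text \<open>For admissible arguments the division is exact: it removes the zeros below the lowest
  height.\<close>

definition nf_at :: "nat \<Rightarrow> (comp \<Rightarrow> bool) \<Rightarrow> (comp \<Rightarrow> nat) \<Rightarrow> (comp \<Rightarrow> nat) \<Rightarrow> (comp \<Rightarrow> nat) \<Rightarrow>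
    comp \<Rightarrow> letter list" where
  "nf_at k \<sigma> v P L i = nf_word k (int (P (prev i)) - int (L i)) (signed_gen (\<sigma> i))
     (v i div k ^ L i) (P i - L i)"

lemma map_nf_digits: "map f (nf_digits k x y N l m) = nf_digits k (f x) (f y) N l m"
  by (simp add: nf_digits_def map_concat o_def)

lemma final_table_component:
  assumes "L i \<le> P i"
  shows "final_table \<sigma> (component k v P L i) = letters (nf_at k \<sigma> v P L i)"
proof -
  let ?f = "slot_mark_map (\<lambda>i. []) (\<lambda>i. letters [signed_gen (\<sigma> i)])"
  have "substitution ?f (nf_digits k (mark i) (Inl (Gen gen_B)) (v i) (L i) (P i)) =
      nf_digits k (Inl (Gen (signed_gen (\<sigma> i)))) (Inl (Gen gen_B)) (v i) (L i) (L i + (P i - L i))"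
    using assms substitution_nf_digits[of ?f "mark i" 1 "Inl (Gen (signed_gen (\<sigma> i)))"]
    by (simp add: nf_digits_def)
  then show ?thesis
    unfolding nf_digits_shift
    by (simp add: final_table_def component_def nf_at_def nf_word_def map_nf_digits)
qed

lemma final_table_configuration:
  assumes "\<And>i. L i \<le> P i"
  shows "final_table \<sigma> (configuration k v P L) =
    map Inl (map Gen (nf_at k \<sigma> v P L C1) @ [Hash] @ map Gen (nf_at k \<sigma> v P L C2) @ [Hash] @
      map Gen (nf_at k \<sigma> v P L C3))"
proof -
  have append: "final_table \<sigma> (u @ w) = final_table \<sigma> u @ final_table \<sigma> w" for u w
    by (simp add: final_table_def)
  have "final_table \<sigma> [Inl Hash] = [Inl Hash]" by (simp add: final_table_def)
  then show ?thesis
    unfolding configuration_def append by (simp add: final_table_component assms o_def)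
qed

lemma signed_gen_cases: "signed_gen s \<in> {gen_a, gen_A}"
  by (simp add: signed_gen_def)

text \<open>Around the cycle given by \<open>prev\<close> these heights telescope, so the
  concatenation is always a closed path.\<close>

lemma height_nf_at:
  assumes "k > 0" "L i \<le> P i"
  shows "height (nf_at k \<sigma> v P L i) = int (P i) - int (P (prev i))"
  using assms by (simp add: nf_at_def height_nf_word[OF _ signed_gen_cases])

lemma val_nf_at:
  assumes "k > 0" "admissible k (v i) (P i) (L i)"
  shows "val k (int (P (prev i))) (nf_at k \<sigma> v P L i) =
    of_int ((if \<sigma> i then 1 else - 1) * int (v i))"
proof -
  have "real (v i div k ^ L i) * real k ^ L i = real (v i)"
    using assms(2) by (simp add: admissible_def flip: of_nat_power of_nat_mult)
  then show ?thesis
    unfolding nf_at_def val_nf_word[OF assms(1) signed_gen_cases] by (simp add: signed_gen_def)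
qed

text \<open>Starting at height \<open>P C3\<close>, each normal form is read from height
  \<open>P (prev i)\<close> and contributes exactly its signed number by
  \<open>val_nf_at\<close>.\<close>

lemma bs_eq_nf_at_iff:
  assumes "k > 0" "\<And>i. admissible k (v i) (P i) (L i)"
  shows "bs_eq k (nf_at k \<sigma> v P L C1 @ nf_at k \<sigma> v P L C2 @ nf_at k \<sigma> v P L C3) [] \<longleftrightarrow>
    signed_sum \<sigma> v = 0"
proof -
  have LP: "L i \<le> P i" for i using assms(2) by (simp add: admissible_def)
  note height = height_nf_at[of k L _ P, OF assms(1) LP]
  note val = val_nf_at[of k v _ P L, OF assms]
  have "val k (int (P C3)) (nf_at k \<sigma> v P L C1 @ nf_at k \<sigma> v P L C2 @ nf_at k \<sigma> v P L C3) =
      of_int (signed_sum \<sigma> v)"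
    using val[of C1 \<sigma>] val[of C2 \<sigma>] val[of C3 \<sigma>] by (simp add: height signed_sum_def UNIV_comp)
  then show ?thesis
    using bs_eq_Nil_iff[OF assms(1), of _ "int (P C3)"] by (simp add: height)
qed

lemma nf_at_in_NF:
  assumes "k \<ge> 2" "admissible k (v i) (P i) (L i)" "L i > 0"
  shows "nf_at k \<sigma> v P L i \<in> NF k"
proof -
  have "P i - L i = 0 \<or> \<not> k dvd v i div k ^ L i"
  proof (cases "L i < P i")
    case True
    with assms have "k ^ L i dvd v i" "\<not> k ^ L i * k dvd v i"
      by (simp_all add: admissible_def mult.commute)
    then show ?thesis using assms(1) by (auto simp: dvd_div_iff_mult mult.commute)
  qed simp
  then show ?thesis
    unfolding NF_iff[OF assms(1)] nf_at_def using signed_gen_cases by blast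
qed

text \<open>The start height is chosen so large that the closed path stays at positive heights.\<close>

lemma closed_triple_eq_nf_at:
  assumes k: "k \<ge> 2" and \<alpha>: "\<And>i. \<alpha> i \<in> {gen_a, gen_A}" and N: "\<And>i. m i = 0 \<or> \<not> k dvd N i"
    and closed: "(\<Sum>i\<in>UNIV. int (m i) - t i) = 0"
  shows "\<exists>\<sigma> v P L. (\<forall>i. admissible k (v i) (P i) (L i) \<and> L i > 0 \<and>
    nf_word k (t i) (\<alpha> i) (N i) (m i) = nf_at k \<sigma> v P L i)"
proof -
  define H where "H = 1 + (\<Sum>i\<in>UNIV. \<bar>t i\<bar> + int (m i))"
  \<comment> \<open>\<open>p i\<close> is the height at which normal form \<open>i\<close> ends when
    the path starts at \<open>H\<close>; closedness brings it back to \<open>H\<close> at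
    \<open>C3\<close>.\<close>
  define p where "p i = (case i of C1 \<Rightarrow> H - t C1 + int (m C1)
    | C2 \<Rightarrow> H - t C1 + int (m C1) - t C2 + int (m C2) | C3 \<Rightarrow> H)" for i
  define P where "P i = nat (p i)" for i
  define L where "L i = nat (p (prev i) - t i)" for i
  define v where "v i = N i * k ^ L i" for i
  define \<sigma> where "\<sigma> i = (\<alpha> i = gen_a)" for i
  \<comment> \<open>These are the lowest heights; the summand \<open>1\<close> in \<open>H\<close>
    makes them strictly positive.\<close>
  have pos: "p (prev i) - t i > 0" for i
    using abs_ge_self[of "t C1"] abs_ge_self[of "t C2"] abs_ge_self[of "t C3"]
    by (cases i) (simp_all add: p_def H_def UNIV_comp)
  have p: "p i = p (prev i) - t i + int (m i)" for i
    using closed by (cases i) (simp_all add: p_def UNIV_comp)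
  have L: "int (L i) = p (prev i) - t i" "L i > 0" for i
    using pos[of i] by (simp_all add: L_def)
  have P: "int (P i) = p i" for i
    using pos[of i] p[of i] by (simp add: P_def)
  have PL: "P i = L i + m i" for i
    using L[of i] P[of i] p[of i] by linarith
  have "admissible k (v i) (P i) (L i)" for i
    using N[of i] k by (auto simp: admissible_def PL v_def)
  moreover have "signed_gen (\<sigma> i) = \<alpha> i" for i
    using \<alpha>[of i] by (auto simp: signed_gen_def \<sigma>_def)
  then have "nf_word k (t i) (\<alpha> i) (N i) (m i) = nf_at k \<sigma> v P L i" for i
    using k by (simp add: nf_at_def L P PL[of i] v_def)
  ultimately show ?thesis using L(2) by blast
qed

lemma derivable_iff_triple:
  assumes k: "k \<ge> 2"
  shows "derivable k w \<longleftrightarrow> (\<exists>x y z. x \<in> NF k \<and> y \<in> NF k \<and> z \<in> NF k \<and> bs_eq k (x @ y @ z) [] \<and>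
    w = map Inl (map Gen x @ [Hash] @ map Gen y @ [Hash] @ map Gen z))"
proof
  assume "derivable k w"
  then obtain \<sigma> v P L where adm: "\<And>i. admissible k (v i) (P i) (L i)" and L: "\<And>i. L i > 0"
    and sum: "signed_sum \<sigma> v = 0" and w: "w = final_table \<sigma> (configuration k v P L)"
    unfolding derivable_def by blast
  have "L i \<le> P i" for i using adm by (simp add: admissible_def)
  note w = w[unfolded final_table_configuration[of L P, OF this]]
  have "bs_eq k (nf_at k \<sigma> v P L C1 @ nf_at k \<sigma> v P L C2 @ nf_at k \<sigma> v P L C3) []"
    using bs_eq_nf_at_iff[of k v P L, OF _ adm] sum k by simp
  moreover have "nf_at k \<sigma> v P L i \<in> NF k" for i
    by (rule nf_at_in_NF[OF k adm L])
  ultimately show "\<exists>x y z. x \<in> NF k \<and> y \<in> NF k \<and> z \<in> NF k \<and> bs_eq k (x @ y @ z) [] \<and>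
      w = map Inl (map Gen x @ [Hash] @ map Gen y @ [Hash] @ map Gen z)"
    using w by blast
next
  assume "\<exists>x y z. x \<in> NF k \<and> y \<in> NF k \<and> z \<in> NF k \<and> bs_eq k (x @ y @ z) [] \<and>
    w = map Inl (map Gen x @ [Hash] @ map Gen y @ [Hash] @ map Gen z)"
  then obtain x y z where NF: "x \<in> NF k" "y \<in> NF k" "z \<in> NF k"
    and eq: "bs_eq k (x @ y @ z) []"
    and w: "w = map Inl (map Gen x @ [Hash] @ map Gen y @ [Hash] @ map Gen z)" by blast
  define X where "X i = (case i of C1 \<Rightarrow> x | C2 \<Rightarrow> y | C3 \<Rightarrow> z)" for i
  have "\<forall>i. X i \<in> NF k" using NF by (simp add: X_def split: comp.split)
  then obtain t \<alpha> N m where \<alpha>: "\<And>i. \<alpha> i \<in> {gen_a, gen_A}" and N: "\<And>i. m i = 0 \<or> \<not> k dvd N i"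
    and X: "\<And>i. X i = nf_word k (t i) (\<alpha> i) (N i) (m i)"
    unfolding NF_iff[OF k] by metis
  \<comment> \<open>The height condition is extracted first, since a closed path is needed to place
    the three words at common heights; the value condition is used afterwards.\<close>
  have "height (X C1 @ X C2 @ X C3) = 0"
    using bs_eq_invariant[OF eq] k by (simp add: X_def)
  then have "int (m C1) - t C1 + (int (m C2) - t C2 + (int (m C3) - t C3)) = 0"
    using k \<alpha> by (simp add: X del: insert_iff)
  then have "(\<Sum>i\<in>UNIV. int (m i) - t i) = 0"
    by (simp add: UNIV_comp)
  from closed_triple_eq_nf_at[of k \<alpha> m N t, OF k \<alpha> N this, folded X]
  obtain \<sigma> v P L where adm: "\<And>i. admissible k (v i) (P i) (L i)" and L: "\<And>i. L i > 0"
    and X': "\<And>i. X i = nf_at k \<sigma> v P L i" by metis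
  have "L i \<le> P i" for i using adm by (simp add: admissible_def)
  note final = final_table_configuration[of L P, OF this]
  have xyz: "x = nf_at k \<sigma> v P L C1" "y = nf_at k \<sigma> v P L C2" "z = nf_at k \<sigma> v P L C3"
    by (simp_all add: X_def flip: X')
  have "signed_sum \<sigma> v = 0"
    using bs_eq_nf_at_iff[of k v P L, OF _ adm] eq k by (simp add: xyz)
  moreover have "w = final_table \<sigma> (configuration k v P L)"
    unfolding w final xyz ..
  ultimately show "derivable k w"
    unfolding derivable_def using adm L by blast
qed

theorem theorem11:
  fixes k :: nat
  assumes "k \<ge> 2"
  shows "EDT0L {map Gen x @ [Hash] @ map Gen y @ [Hash] @ map Gen z | x y z.
           x \<in> NF k \<and> y \<in> NF k \<and> z \<in> NF k \<and>
           elt k (x @ y) = inv\<^bsub>BS k\<^esub> (elt k z)}"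
    (is "EDT0L ?L")
proof -
  have "w \<in> map Inl ` ?L \<longleftrightarrow> w \<in> edt0l_language (range Inl) (control k) start_word" for w
  proof -
    have "w \<in> map Inl ` ?L \<longleftrightarrow> derivable k w"
      unfolding derivable_iff_triple[OF assms] elt_eq_inv_iff append_assoc by blast
    \<comment> \<open>No slot or mark is left in a derivable word, so the restriction to terminal
      words in \<open>edt0l_language\<close> removes nothing.\<close>
    moreover have "derivable k w \<Longrightarrow> w \<in> lists (range Inl)"
      unfolding derivable_iff_triple[OF assms] by auto
    ultimately show ?thesis
      unfolding edt0l_language_def using derivable_iff[OF assms, of w] by blast
  qed
  then have "map Inl ` ?L = edt0l_language (range Inl) (control k) start_word" by blast
  with edt0l_system_control show ?thesis unfolding EDT0L_def by blast
qed

end
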